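(* For every linearly ordered set $J$, the class $\mathrm{NA}(\mathcal{B}_J)$ of naturally ordered finite Boolean algebras with an increasing $J$-chain of ideals satisfies the Ramsey property.
   Context: Let $J$ be a linearly ordered set and let $L_J=\{\vee,\wedge,0,1,\neg\}\cup\{P_j:j\in J\}$ be the language of Boolean algebras expanded by unary predicate symbols $P_j$ ($j\in J$). An ideal on a Boolean algebra is a subset containing $0$, downward closed under the canonical order and closed under finite joins; ideals are assumed non-trivial, i.e. not containing $1$. $\mathcal{B}_J$ is the class of (isomorphism types of) finite Boolean algebras $A$ in the language $L_J$ in which each $P_j$ is interpreted as an ideal, $P_i\subseteq P_j$ for $i<j$ in $J$, and at least one atom of $A$ lies in no $P_j$, $j\in J$. Proper and natural orderings: a linear ordering $<$ of the atoms of a finite $L_J$-algebra $A$ is proper if for all atoms $a,b$ of $A$ and all $i\in J$ with $a\in P_i$, we have $a<b$ whenever either $b\in P_j\setminus P_i$ for some $j>i$, or $b\notin P_k$ for every $k\in J$. A linear ordering of $A$ is natural if it is the antilexicographical extension of a proper ordering $a_1<\dots<a_n$ of its atoms: for distinct $x,y\in A$, $x<y$ iff, for the largest $m$ such that exactly one of $a_m\le x$, $a_m\le y$ holds (with $\le$ the Boolean order), we have $a_m\le y$. $\mathrm{NA}(\mathcal{B}_J)$ is the class of all structures $(A,<)$ in the language $L_J\cup\{<\}$ with $A\in\mathcal{B}_J$ and $<$ a natural ordering of $A$. Ramsey property: a class $\mathcal{K}$ of finite structures satisfies the Ramsey property if for all $A,B\in\mathcal{K}$ such that $A$ embeds in $B$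 and every natural number $k\ge 2$ there is $C\in\mathcal{K}$ such that for every colouring by $k$ colours of the set of copies of $A$ in $C$ (substructures of $C$ isomorphic to $A$) there is a copy $B'$ of $B$ in $C$ such that all copies of $A$ in $B'$ have the same colour. *)

theory Defs
  imports Main "HOL-Library.FuncSet"
begin

text \<open>
  Structures in the language of Boolean algebras with unary predicates indexed by \<open>'j\<close>,
  and their expansions by a binary relation. For a linearly ordered index set \<open>J\<close> (possibly empty,
  hence a set rather than a type) only the predicates \<open>pred A j\<close> with \<open>j \<in> J\<close> belong to the
  language; the other values of \<open>pred A\<close> are ignored.
\<close>

record ('a, 'j) pred_alg =
  carrier :: "'a set"
  join :: "'a \<Rightarrow> 'a \<Rightarrow> 'a" (infixl "\<squnion>\<index>" 65)
  meet :: "'a \<Rightarrow> 'a \<Rightarrow> 'a" (infixl "\<sqinter>\<index>" 70)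
  bzero :: 'a ("\<zero>\<index>")
  bone :: 'a ("\<one>\<index>")
  neg :: "'a \<Rightarrow> 'a" ("\<sim>\<index> _" [81] 80)
  pred :: "'j \<Rightarrow> 'a set"

record ('a, 'j) ord_pred_alg = "('a, 'j) pred_alg" +
  ord :: "('a \<times> 'a) set"

locale bool_alg =
  fixes A :: "('a, 'j, 'm) pred_alg_scheme" (structure)
  assumes join_closed: "\<lbrakk>x \<in> carrier A; y \<in> carrier A\<rbrakk> \<Longrightarrow> x \<squnion> y \<in> carrier A"
    and meet_closed: "\<lbrakk>x \<in> carrier A; y \<in> carrier A\<rbrakk> \<Longrightarrow> x \<sqinter> y \<in> carrier A"
    and zero_closed: "\<zero> \<in> carrier A"
    and one_closed: "\<one> \<in> carrier A"
    and neg_closed: "x \<in> carrier A \<Longrightarrow> \<sim> x \<in> carrier A"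
    and join_comm: "\<lbrakk>x \<in> carrier A; y \<in> carrier A\<rbrakk> \<Longrightarrow> x \<squnion> y = y \<squnion> x"
    and meet_comm: "\<lbrakk>x \<in> carrier A; y \<in> carrier A\<rbrakk> \<Longrightarrow> x \<sqinter> y = y \<sqinter> x"
    and join_assoc: "\<lbrakk>x \<in> carrier A; y \<in> carrier A; z \<in> carrier A\<rbrakk>
      \<Longrightarrow> (x \<squnion> y) \<squnion> z = x \<squnion> (y \<squnion> z)"
    and meet_assoc: "\<lbrakk>x \<in> carrier A; y \<in> carrier A; z \<in> carrier A\<rbrakk>
      \<Longrightarrow> (x \<sqinter> y) \<sqinter> z = x \<sqinter> (y \<sqinter> z)"
    and join_absorb: "\<lbrakk>x \<in> carrier A; y \<in> carrier A\<rbrakk> \<Longrightarrow> x \<squnion> (x \<sqinter> y) = x"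
    and meet_absorb: "\<lbrakk>x \<in> carrier A; y \<in> carrier A\<rbrakk> \<Longrightarrow> x \<sqinter> (x \<squnion> y) = x"
    and meet_distrib: "\<lbrakk>x \<in> carrier A; y \<in> carrier A; z \<in> carrier A\<rbrakk>
      \<Longrightarrow> x \<sqinter> (y \<squnion> z) = (x \<sqinter> y) \<squnion> (x \<sqinter> z)"
    and join_distrib: "\<lbrakk>x \<in> carrier A; y \<in> carrier A; z \<in> carrier A\<rbrakk>
      \<Longrightarrow> x \<squnion> (y \<sqinter> z) = (x \<squnion> y) \<sqinter> (x \<squnion> z)"
    and join_neg: "x \<in> carrier A \<Longrightarrow> x \<squnion> \<sim> x = \<one>"
    and meet_neg: "x \<in> carrier A \<Longrightarrow> x \<sqinter> \<sim> x = \<zero>"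

definition below :: "('a, 'j, 'm) pred_alg_scheme \<Rightarrow> 'a \<Rightarrow> 'a \<Rightarrow> bool" where
  "below A x y \<longleftrightarrow> x \<sqinter>\<^bsub>A\<^esub> y = x"

definition atoms :: "('a, 'j, 'm) pred_alg_scheme \<Rightarrow> 'a set" where
  "atoms A = {a \<in> carrier A. a \<noteq> \<zero>\<^bsub>A\<^esub> \<and>
     (\<forall>x\<in>carrier A. below A x a \<longrightarrow> x = \<zero>\<^bsub>A\<^esub> \<or> x = a)}"

definition is_ideal :: "('a, 'j, 'm) pred_alg_scheme \<Rightarrow> 'a set \<Rightarrow> bool" where
  "is_ideal A I \<longleftrightarrow> I \<subseteq> carrier A \<and> \<zero>\<^bsub>A\<^esub> \<in> I \<and>
     (\<forall>y\<in>I. \<forall>x\<in>carrier A. below A x y \<longrightarrow> x \<in> I) \<and>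
     (\<forall>x\<in>I. \<forall>y\<in>I. x \<squnion>\<^bsub>A\<^esub> y \<in> I) \<and>
     \<one>\<^bsub>A\<^esub> \<notin> I"

definition ideal_chain_algs :: "'j::linorder set \<Rightarrow> ('a, 'j, 'm) pred_alg_scheme set" where
  "ideal_chain_algs J = {A. bool_alg A \<and> finite (carrier A) \<and>
     (\<forall>j\<in>J. is_ideal A (pred A j)) \<and>
     (\<forall>i\<in>J. \<forall>j\<in>J. i < j \<longrightarrow> pred A i \<subseteq> pred A j) \<and>
     (\<exists>a\<in>atoms A. \<forall>j\<in>J. a \<notin> pred A j)}"

definition proper_ordering ::
    "'j::linorder set \<Rightarrow> ('a, 'j, 'm) pred_alg_scheme \<Rightarrow> ('a \<times> 'a) set \<Rightarrow> bool" where
  "proper_ordering J A r \<longleftrightarrow>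
     r \<subseteq> atoms A \<times> atoms A \<and> strict_linear_order_on (atoms A) r \<and>
     (\<forall>a\<in>atoms A. \<forall>b\<in>atoms A. \<forall>i\<in>J. a \<in> pred A i \<longrightarrow>
        (\<exists>j\<in>J. i < j \<and> b \<in> pred A j - pred A i) \<or> (\<forall>k\<in>J. b \<notin> pred A k) \<longrightarrow> (a, b) \<in> r)"

definition separates :: "('a, 'j, 'm) pred_alg_scheme \<Rightarrow> 'a \<Rightarrow> 'a \<Rightarrow> 'a \<Rightarrow> bool" where
  "separates A a x y \<longleftrightarrow> below A a x \<noteq> below A a y"

definition antilex :: "('a, 'j, 'm) pred_alg_scheme \<Rightarrow> ('a \<times> 'a) set \<Rightarrow> ('a \<times> 'a) set" where
  "antilex A r = {(x, y). x \<in> carrier A \<and> y \<in> carrier A \<and> x \<noteq> y \<and>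
     (\<exists>a\<in>atoms A. separates A a x y \<and>
        (\<forall>b\<in>atoms A. separates A b x y \<longrightarrow> b = a \<or> (b, a) \<in> r) \<and>
        below A a y)}"

definition natural_ordering ::
    "'j::linorder set \<Rightarrow> ('a, 'j, 'm) pred_alg_scheme \<Rightarrow> ('a \<times> 'a) set \<Rightarrow> bool" where
  "natural_ordering J A R \<longleftrightarrow>
     R \<subseteq> carrier A \<times> carrier A \<and> strict_linear_order_on (carrier A) R \<and>
     (\<exists>r. proper_ordering J A r \<and> R = antilex A r)"

definition NA :: "'j::linorder set \<Rightarrow> ('a, 'j) ord_pred_alg set" where
  "NA J = {A. A \<in> ideal_chain_algs J \<and> natural_ordering J A (ord A)}"

definition embedding ::
    "'j set \<Rightarrow> ('a, 'j) ord_pred_alg \<Rightarrow> ('b, 'j) ord_pred_alg \<Rightarrow> ('a \<Rightarrow> 'b) \<Rightarrow> bool" where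
  "embedding J A B h \<longleftrightarrow>
     h ` carrier A \<subseteq> carrier B \<and> inj_on h (carrier A) \<and>
     (\<forall>x\<in>carrier A. \<forall>y\<in>carrier A. h (x \<squnion>\<^bsub>A\<^esub> y) = h x \<squnion>\<^bsub>B\<^esub> h y) \<and>
     (\<forall>x\<in>carrier A. \<forall>y\<in>carrier A. h (x \<sqinter>\<^bsub>A\<^esub> y) = h x \<sqinter>\<^bsub>B\<^esub> h y) \<and>
     h \<zero>\<^bsub>A\<^esub> = \<zero>\<^bsub>B\<^esub> \<and> h \<one>\<^bsub>A\<^esub> = \<one>\<^bsub>B\<^esub> \<and>
     (\<forall>x\<in>carrier A. h (\<sim>\<^bsub>A\<^esub> x) = \<sim>\<^bsub>B\<^esub> (h x)) \<and>
     (\<forall>j\<in>J. \<forall>x\<in>carrier A. x \<in> pred A j \<longleftrightarrow> h x \<in> pred B j) \<and>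
     (\<forall>x\<in>carrier A. \<forall>y\<in>carrier A. (x, y) \<in> ord A \<longleftrightarrow> (h x, h y) \<in> ord B)"

definition embeds :: "'j set \<Rightarrow> ('a, 'j) ord_pred_alg \<Rightarrow> ('b, 'j) ord_pred_alg \<Rightarrow> bool" where
  "embeds J A B \<longleftrightarrow> (\<exists>h. embedding J A B h)"

definition isomorphic :: "'j set \<Rightarrow> ('a, 'j) ord_pred_alg \<Rightarrow> ('b, 'j) ord_pred_alg \<Rightarrow> bool" where
  "isomorphic J A B \<longleftrightarrow> (\<exists>h. embedding J A B h \<and> h ` carrier A = carrier B)"

definition subuniverse :: "('a, 'j, 'm) pred_alg_scheme \<Rightarrow> 'a set \<Rightarrow> bool" where
  "subuniverse C S \<longleftrightarrow> S \<subseteq> carrier C \<and> \<zero>\<^bsub>C\<^esub> \<in> S \<and> \<one>\<^bsub>C\<^esub> \<in> S \<and>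
     (\<forall>x\<in>S. \<forall>y\<in>S. x \<squnion>\<^bsub>C\<^esub> y \<in> S \<and> x \<sqinter>\<^bsub>C\<^esub> y \<in> S) \<and> (\<forall>x\<in>S. \<sim>\<^bsub>C\<^esub> x \<in> S)"

text \<open>
  The operations of the substructure on \<open>S\<close> are kept as total functions, so there is exactly one
  record per subuniverse, and substructures of substructures of \<open>C\<close> are again of the form
  \<open>substructure C S\<close>.
\<close>

definition substructure :: "('a, 'j) ord_pred_alg \<Rightarrow> 'a set \<Rightarrow> ('a, 'j) ord_pred_alg" where
  "substructure C S =
     C\<lparr>carrier := S, pred := (\<lambda>j. pred C j \<inter> S), ord := ord C \<inter> S \<times> S\<rparr>"

definition copies ::
    "'j set \<Rightarrow> ('a, 'j) ord_pred_alg \<Rightarrow> ('b, 'j) ord_pred_alg \<Rightarrow> ('b, 'j) ord_pred_alg set" where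
  "copies J A C = {substructure C S | S. subuniverse C S \<and> isomorphic J A (substructure C S)}"

text \<open>
  A class of finite structures is a set of structures with carriers in a fixed infinite type; at
  \<open>'a = nat\<close> every isomorphism type of finite structures is represented.
\<close>

definition ramsey_property :: "'j set \<Rightarrow> ('a, 'j) ord_pred_alg set \<Rightarrow> bool" where
  "ramsey_property J K \<longleftrightarrow>
     (\<forall>A\<in>K. \<forall>B\<in>K. embeds J A B \<longrightarrow>
       (\<forall>k::nat. k \<ge> 2 \<longrightarrow>
         (\<exists>C\<in>K. \<forall>\<chi> \<in> copies J A C \<rightarrow> {..<k}.
            \<exists>B'\<in>copies J B C. \<forall>A1\<in>copies J A B'. \<forall>A2\<in>copies J A B'. \<chi> A1 = \<chi> A2)))"

end

theory Submission
  imports Defs "HOL-Library.Nat_Bijection" "HOL-Library.Ramsey"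
begin

text \<open>
  The idea is to dualize. An algebra in the class is determined by its atoms, listed from the
  largest to the smallest, together with the type of each atom, the set of those \<open>j\<close> for which the
  atom lies in the ideal of index \<open>j\<close>. The types are upward closed in \<open>J\<close>, hence comparable
  under inclusion, and an ordering of the atoms is proper exactly when the types increase along this
  list; the first type is empty because some atom avoids all ideals. So the objects become
  increasing lists of types.

  An embedding of \<open>A\<close> into \<open>C\<close> partitions the atoms of \<open>C\<close> according to the atom of \<open>A\<close> under whose
  image they lie, so it is a labelling of the list of \<open>C\<close> by the positions of the list of \<open>A\<close>. It respects the antilexicographic
  order iff the labels make their first appearance in increasing order, and it respects the ideals
  iff a label and the atom at which it appears first have the same type. Indeed the type of a join
  of atoms is the intersection of their types, which for an increasing list is the type that comes
  first. What has to be shown is therefore a dual Ramsey theorem for words whose letters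
  have their first occurrences at places of a prescribed type.

  This typed dual Ramsey theorem (\<open>block_ramsey\<close>) is proved by adding one type at a time. The part of
  a word that belongs to a new type is a parameter word in the sense of Graham and Rothschild: the
  letters of the earlier types act as constants, the letters of the new type as parameters. The
  point is to apply the Graham-Rothschild theorem over the large alphabet consisting of all places
  of the earlier part of \<open>C\<close>, and not over the letters of \<open>A\<close> or \<open>B\<close>; only then can the constants of
  the monochromatic parameter word be identified afterwards, as the earlier part demands. After this
  step the colour depends on the earlier part alone, and the induction hypothesis applies.

  The Graham-Rothschild theorem itself (\<open>graham_rothschild\<close>) comes from the Hales-Jewett theorem, in
  Shelah's version of the proof, and the finite Ramsey theorem. Repeated use of
  Hales-Jewett yields a long parameter word in which the colour of a substitution instance depends
  only on its length and on the places where its letters occur first (\<open>canonical_chain\<close>). These data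
  form a finite set of numbers, so Ramsey's theorem makes the colour constant.
\<close>

section \<open>Words with parameters\<close>

text \<open>
  Colourings with values in a product are used throughout: one wants a single word that is
  monochromatic for finitely many colourings at once, and coding them by one number reduces this to
  a single colouring whose number of colours does not depend on the family.
\<close>

lemma finite_family_coding:
  fixes I :: "'i set" and r :: nat
  assumes "finite I"
  obtains s :: nat where "\<And>F :: 'a \<Rightarrow> 'i \<Rightarrow> nat. (\<And>x i. i \<in> I \<Longrightarrow> F x i < r) \<Longrightarrow>
    \<exists>c. (\<forall>x. c x < s) \<and> (\<forall>x y. c x = c y \<longrightarrow> (\<forall>i\<in>I. F x i = F y i))"
proof -
  let ?X = "I \<rightarrow>\<^sub>E {..<r}"
  have "finite ?X"
    using assms by (simp add: finite_PiE)
  then obtain enc where enc: "bij_betw enc ?X {0..<card ?X}"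
    using ex_bij_betw_finite_nat by blast
  show thesis
  proof (rule that[of "card ?X"])
    fix F :: "'a \<Rightarrow> 'i \<Rightarrow> nat"
    assume F: "\<And>x i. i \<in> I \<Longrightarrow> F x i < r"
    have X: "restrict (F x) I \<in> ?X" for x
      using F by auto
    have "enc (restrict (F x) I) < card ?X" for x
      using bij_betwE[OF enc] X by force
    moreover have "F x i = F y i"
      if "enc (restrict (F x) I) = enc (restrict (F y) I)" "i \<in> I" for x y i
    proof -
      have "restrict (F x) I = restrict (F y) I"
        using inj_on_eq_iff[OF bij_betw_imp_inj_on[OF enc] X X] that(1) by metis
      then show ?thesis
        using that(2) by (metis restrict_apply')
    qed
    ultimately show "\<exists>c. (\<forall>x. c x < card ?X) \<and> (\<forall>x y. c x = c y \<longrightarrow> (\<forall>i\<in>I. F x i = F y i))"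
      by (intro exI[of _ "\<lambda>x. enc (restrict (F x) I)"]) blast
  qed
qed

text \<open>
  Letters below \<open>d\<close> are constants and the letter \<open>d + p\<close> is the parameter of index \<open>p\<close>; substituting
  the word \<open>f\<close> for the parameters of \<open>g\<close> is the composition of parameter words.
\<close>

definition plug :: "nat \<Rightarrow> nat list \<Rightarrow> nat list \<Rightarrow> nat list" where
  "plug d f g = map (\<lambda>x. if x < d then x else f ! (x - d)) g"

lemma length_plug [simp]: "length (plug d f g) = length g"
  by (simp add: plug_def)

lemma plug_append [simp]: "plug d f (g @ h) = plug d f g @ plug d f h"
  by (simp add: plug_def)

lemma plug_Cons: "plug d f (x # g) = (if x < d then x else f ! (x - d)) # plug d f g"
  by (simp add: plug_def)

lemma plug_cong_prefix:
  assumes "set g \<subseteq> {..<d + length f}"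
  shows "plug d (f @ f') g = plug d f g"
  using assms by (auto simp: plug_def nth_append)

lemma set_plug_subset:
  assumes "set g \<subseteq> {..<d + length f}" "set f \<subseteq> {..<e}" "d \<le> e"
  shows "set (plug d f g) \<subseteq> {..<e}"
proof
  fix y assume "y \<in> set (plug d f g)"
  then obtain x where x: "x \<in> set g" "y = (if x < d then x else f ! (x - d))"
    by (auto simp: plug_def)
  show "y \<in> {..<e}"
  proof (cases "x < d")
    case False
    then have "x - d < length f"
      using x(1) assms(1) by auto
    then have "f ! (x - d) \<in> set f" by simp
    then show ?thesis using False x(2) assms(2) by auto
  qed (use x assms(3) in auto)
qed

section \<open>The Hales-Jewett theorem\<close>

definition inst :: "nat \<Rightarrow> nat \<Rightarrow> nat list \<Rightarrow> nat list" where
  "inst t k h = map (\<lambda>x. if x = t then k else x) h"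

definition hales_jewett_number :: "nat \<Rightarrow> nat \<Rightarrow> nat \<Rightarrow> bool" where
  "hales_jewett_number t r N \<longleftrightarrow> (\<forall>\<chi> :: nat list \<Rightarrow> nat. (\<forall>w. \<chi> w < r) \<longrightarrow>
     (\<exists>h. length h = N \<and> set h \<subseteq> {..t} \<and> t \<in> set h \<and>
        (\<forall>k<t. \<forall>k'<t. \<chi> (inst t k h) = \<chi> (inst t k' h))))"

lemma finite_words: "finite {w :: nat list. length w = n \<and> set w \<subseteq> {..<m}}"
  using finite_lists_length_eq[of "{..<m}" n] by (simp add: conj_commute)

text \<open>
  Shelah's step: a parameter word over the alphabet with \<open>u + 2\<close> letters all of whose instances keep
  their colour when the last letter \<open>u + 1\<close> is replaced by \<open>u\<close>. The parameters are introduced one at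
  a time, each in a block of its own. The earlier blocks are obtained from the induction hypothesis
  for the colouring that records the colours of all continuations, while the new block needs to work
  for all the finitely many words that may stand before it.
\<close>

lemma shelah_insensitive:
  fixes u M r :: nat
  shows "\<exists>N. \<forall>\<chi> :: nat list \<Rightarrow> nat. (\<forall>w. \<chi> w < r) \<longrightarrow>
    (\<exists>g. length g = N \<and> set g \<subseteq> {..<u + 2 + M} \<and> {u + 2..<u + 2 + M} \<subseteq> set g \<and>
       (\<forall>f. length f = M \<and> set f \<subseteq> {..<u + 2} \<longrightarrow>
          \<chi> (plug (u + 2) f g) = \<chi> (plug (u + 2) (map (min u) f) g)))"
proof (induction M arbitrary: r)
  case 0
  show ?case by (intro exI[of _ 0]) auto
next
  case (Suc M)
  define d where "d = u + 2"
  obtain s :: nat where s: "\<And>F :: nat list \<Rightarrow> nat \<Rightarrow> nat. (\<And>w x. x \<in> {..<d} \<Longrightarrow> F w x < r) \<Longrightarrow>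
    \<exists>c. (\<forall>w. c w < s) \<and> (\<forall>w w'. c w = c w' \<longrightarrow> (\<forall>x\<in>{..<d}. F w x = F w' x))"
    by (rule finite_family_coding[of "{..<d}" r, where ?'a = "nat list"]) blast+
  obtain N1 where N1: "\<And>\<chi> :: nat list \<Rightarrow> nat. (\<forall>w. \<chi> w < s) \<Longrightarrow>
    (\<exists>g. length g = N1 \<and> set g \<subseteq> {..<d + M} \<and> {d..<d + M} \<subseteq> set g \<and>
       (\<forall>f. length f = M \<and> set f \<subseteq> {..<d} \<longrightarrow>
          \<chi> (plug d f g) = \<chi> (plug d (map (min u) f) g)))"
    using Suc.IH[of s] unfolding d_def by blast
  define W where "W = {w :: nat list. length w = N1 \<and> set w \<subseteq> {..<d}}"
  have "finite W" unfolding W_def by (rule finite_words)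
  then obtain R :: nat where R: "\<And>F :: nat \<Rightarrow> nat list \<Rightarrow> nat. (\<And>a w. w \<in> W \<Longrightarrow> F a w < r) \<Longrightarrow>
    \<exists>c. (\<forall>a. c a < R) \<and> (\<forall>a b. c a = c b \<longrightarrow> (\<forall>w\<in>W. F a w = F b w))"
    by (rule finite_family_coding[of W r, where ?'a = nat]) blast+
  show ?case
    unfolding d_def[symmetric]
  proof (intro exI[of _ "N1 + R"] allI impI)
    fix \<chi> :: "nat list \<Rightarrow> nat"
    assume chi: "\<forall>w. \<chi> w < r"
    \<comment> \<open>The new block comes from the \<open>R + 1\<close> staircase words, for which only \<open>R\<close> colours are available:
      two of them agree, and the stretch where they differ carries the new parameter.\<close>
    define st where "st a = replicate a (u + 1) @ replicate (R - a) u" for a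
    obtain c where c: "\<forall>a. c a < R" "\<forall>a b. c a = c b \<longrightarrow> (\<forall>w\<in>W. \<chi> (w @ st a) = \<chi> (w @ st b))"
      using R[of "\<lambda>a w. \<chi> (w @ st a)", OF spec[OF chi]] by blast
    have "\<not> inj_on c {..R}"
      using c(1) card_inj_on_le[of c "{..R}" "{..<R}"] by auto
    then obtain a b where ab: "a < b" "b \<le> R" "c a = c b"
      unfolding inj_on_def by (metis atMost_iff linorder_neqE_nat)
    define h where "h = replicate a (u + 1) @ replicate (b - a) (d + M) @ replicate (R - b) u"
    define hx where "hx x = replicate a (u + 1) @ replicate (b - a) x @ replicate (R - b) u" for x
    have len_h: "length h = R"
      unfolding h_def using ab by simp
    have hx1: "hx (u + 1) = st b"
      unfolding hx_def st_def using ab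
      by (simp add: append_assoc[symmetric] replicate_add[symmetric] del: append_assoc)
    have hx0: "hx u = st a"
      unfolding hx_def st_def using ab by (simp add: replicate_add[symmetric])
    have swap: "\<chi> (w @ hx (u + 1)) = \<chi> (w @ hx u)" if "w \<in> W" for w
      unfolding hx1 hx0 using c(2) ab(3) that by metis
    have min_swap: "\<chi> (w @ hx x) = \<chi> (w @ hx (min u x))" if "w \<in> W" "x < d" for w x
      using swap[OF that(1)] that(2) unfolding d_def
      by (cases "x = u + 1"; cases "x = u") (auto simp: min_def)
    obtain c' where c': "\<forall>w. c' w < s"
      "\<forall>w w'. c' w = c' w' \<longrightarrow> (\<forall>x\<in>{..<d}. \<chi> (w @ hx x) = \<chi> (w' @ hx x))"
      using s[of "\<lambda>w x. \<chi> (w @ hx x)", OF spec[OF chi]] by blast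
    obtain g where g: "length g = N1" "set g \<subseteq> {..<d + M}" "{d..<d + M} \<subseteq> set g"
      "\<And>f. length f = M \<Longrightarrow> set f \<subseteq> {..<d} \<Longrightarrow> c' (plug d f g) = c' (plug d (map (min u) f) g)"
      using N1[OF c'(1)] by blast
    show "\<exists>g. length g = N1 + R \<and> set g \<subseteq> {..<d + Suc M} \<and> {d..<d + Suc M} \<subseteq> set g \<and>
       (\<forall>f. length f = Suc M \<and> set f \<subseteq> {..<d} \<longrightarrow>
          \<chi> (plug d f g) = \<chi> (plug d (map (min u) f) g))"
    proof (intro exI[of _ "g @ h"] conjI allI impI)
      show "length (g @ h) = N1 + R" using g len_h by simp
      have "set h \<subseteq> {..<d + Suc M}" unfolding h_def d_def by auto
      then show "set (g @ h) \<subseteq> {..<d + Suc M}" using g(2) by auto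
      have "d + M \<in> set h" unfolding h_def using ab by simp
      then show "{d..<d + Suc M} \<subseteq> set (g @ h)"
        using g(3) by (auto simp: less_Suc_eq)
      fix f assume f: "length f = Suc M \<and> set f \<subseteq> {..<d}"
      then obtain f1 x where fx: "f = f1 @ [x]" "length f1 = M"
        by (metis length_Suc_conv_rev)
      have x: "x < d" and f1: "set f1 \<subseteq> {..<d}" using f fx by auto
      have plug_h: "plug d (f' @ [y]) h = hx y" if "length f' = M" for f' y
        unfolding plug_def h_def hx_def d_def using that by (simp add: nth_append)
      have plug_gh: "plug d (f' @ [y]) (g @ h) = plug d f' g @ hx y" if "length f' = M" for f' y
        using plug_h[OF that] plug_cong_prefix[of g d f' "[y]"] g(2) that by simp
      have inW: "plug d f' g \<in> W" if "length f' = M" "set f' \<subseteq> {..<d}" for f'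
        unfolding W_def using g(1,2) set_plug_subset[of g d f' d] that by simp
      have minf: "length (map (min u) f1) = M" "set (map (min u) f1) \<subseteq> {..<d}"
        using fx f1 by (auto simp: d_def)
      have "\<chi> (plug d f (g @ h)) = \<chi> (plug d f1 g @ hx x)"
        using plug_gh fx by simp
      also have "\<dots> = \<chi> (plug d (map (min u) f1) g @ hx x)"
        using c'(2) g(4)[OF fx(2) f1] x by blast
      also have "\<dots> = \<chi> (plug d (map (min u) f1) g @ hx (min u x))"
        using min_swap[OF inW[OF minf] x] .
      also have "\<dots> = \<chi> (plug d (map (min u) f) (g @ h))"
        using plug_gh[OF minf(1), of "min u x"] fx by simp
      finally show "\<chi> (plug d f (g @ h)) = \<chi> (plug d (map (min u) f) (g @ h))" .
    qed
  qed
qed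

text \<open>
  On the subspace provided by \<open>shelah_insensitive\<close> the two largest letters cannot be told apart, so
  a line for the alphabet without the largest letter is monochromatic for the larger alphabet, too.
\<close>

theorem hales_jewett: "\<exists>N. hales_jewett_number t r N"
proof (induction t arbitrary: r)
  case 0
  show ?case
    unfolding hales_jewett_number_def by (intro exI[of _ 1] allI impI exI[of _ "[0]"]) auto
next
  case (Suc t)
  show ?case
  proof (cases t)
    case 0
    then show ?thesis
      unfolding hales_jewett_number_def by (intro exI[of _ 1] allI impI exI[of _ "[1]"]) auto
  next
    case u: (Suc u)
    define d where "d = u + 2"
    have t: "t = u + 1" "Suc t = d" using u d_def by auto
    obtain M where M: "hales_jewett_number t r M" using Suc.IH by blast
    obtain N where N: "\<And>\<chi> :: nat list \<Rightarrow> nat. (\<forall>w. \<chi> w < r) \<Longrightarrow>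
      (\<exists>g. length g = N \<and> set g \<subseteq> {..<d + M} \<and> {d..<d + M} \<subseteq> set g \<and>
       (\<forall>f. length f = M \<and> set f \<subseteq> {..<d} \<longrightarrow>
          \<chi> (plug d f g) = \<chi> (plug d (map (min u) f) g)))"
      using shelah_insensitive[of r u M] unfolding d_def by blast
    show ?thesis
      unfolding hales_jewett_number_def t(2)
    proof (intro exI[of _ N] allI impI)
      fix \<chi> :: "nat list \<Rightarrow> nat"
      assume chi: "\<forall>w. \<chi> w < r"
      obtain g where g: "length g = N" "set g \<subseteq> {..<d + M}" "{d..<d + M} \<subseteq> set g"
        "\<And>f. length f = M \<Longrightarrow> set f \<subseteq> {..<d} \<Longrightarrow> \<chi> (plug d f g) = \<chi> (plug d (map (min u) f) g)"
        using N[OF chi] by blast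
      obtain l where l: "length l = M" "set l \<subseteq> {..t}" "t \<in> set l"
        "\<And>k k'. k < t \<Longrightarrow> k' < t \<Longrightarrow> \<chi> (plug d (inst t k l) g) = \<chi> (plug d (inst t k' l) g)"
        using M[unfolded hales_jewett_number_def, rule_format, of "\<lambda>f. \<chi> (plug d f g)"] chi by blast
      define h where "h = plug d (inst t d l) g"
      have inst_h: "inst d k h = plug d (inst t k l) g" for k
      proof -
        have "(if (if x < d then x else inst t d l ! (x - d)) = d then k
                 else (if x < d then x else inst t d l ! (x - d)))
              = (if x < d then x else inst t k l ! (x - d))" if "x \<in> set g" for x
        proof (cases "x < d")
          case False
          then have "x - d < length l" using that g(2) l(1) by auto
          moreover from this have "l ! (x - d) \<le> t" using l(2) nth_mem by blast
          ultimately show ?thesis using False t by (auto simp: inst_def)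
        qed simp
        then show ?thesis
          unfolding h_def plug_def by (simp add: inst_def[of d])
      qed
      have eq: "\<chi> (inst d k h) = \<chi> (inst d u h)" if "k < d" for k
      proof (cases "k < t")
        case True
        then show ?thesis using l(4)[of k u] inst_h t by simp
      next
        case False
        then have k: "k = t" using that t by simp
        have "map (min u) (inst t t l) = inst t u l"
          unfolding inst_def using l(2) t by (auto simp: min_def)
        moreover have "length (inst t t l) = M" "set (inst t t l) \<subseteq> {..<d}"
          unfolding inst_def using l t by auto
        ultimately show ?thesis using g(4)[of "inst t t l"] inst_h k by simp
      qed
      show "\<exists>h. length h = N \<and> set h \<subseteq> {..d} \<and> d \<in> set h \<and>
        (\<forall>k<d. \<forall>k'<d. \<chi> (inst d k h) = \<chi> (inst d k' h))"
      proof (intro exI[of _ h] conjI allI impI)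
        show "length h = N" unfolding h_def using g by simp
        have "set (inst t d l) \<subseteq> {..<Suc d}" unfolding inst_def using l(2) t by auto
        then have "set h \<subseteq> {..<Suc d}"
          unfolding h_def using g(2) l(1) by (intro set_plug_subset) (auto simp: inst_def)
        then show "set h \<subseteq> {..d}" by auto
        obtain p where p: "p < M" "l ! p = t" using l(1,3) by (metis in_set_conv_nth)
        then have "d + p \<in> set g" using g(3) by auto
        moreover have "inst t d l ! p = d" using p l(1) by (simp add: inst_def)
        ultimately show "d \<in> set h" unfolding h_def plug_def by force
        show "\<chi> (inst d k h) = \<chi> (inst d k' h)" if "k < d" "k' < d" for k k'
          using eq that by metis
      qed
    qed
  qed
qed

section \<open>Rigid words and the positions of first occurrences\<close>

text \<open>
  Words over \<open>d\<close> constants in which the parameters \<open>d, \<dots>, e - 1\<close> appear in their natural order,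
  together with the set \<open>P\<close> of the positions at which a parameter appears for the first time. The set
  is carried along because it is the invariant of a word on which colours will depend.
\<close>

inductive rigid_word :: "nat \<Rightarrow> nat list \<Rightarrow> nat \<Rightarrow> nat set \<Rightarrow> bool" for d where
  Nil: "rigid_word d [] d {}"
| old: "rigid_word d w e P \<Longrightarrow> x < e \<Longrightarrow> rigid_word d (w @ [x]) e P"
| new: "rigid_word d w e P \<Longrightarrow> rigid_word d (w @ [e]) (Suc e) (insert (length w) P)"

lemma rigid_word_le: "rigid_word d w e P \<Longrightarrow> d \<le> e"
  by (induction rule: rigid_word.induct) auto

lemma rigid_word_set: "rigid_word d w e P \<Longrightarrow> set w \<subseteq> {..<e}"
  by (induction rule: rigid_word.induct) (auto simp: less_Suc_eq)

lemma rigid_word_surj: "rigid_word d w e P \<Longrightarrow> {d..<e} \<subseteq> set w"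
  by (induction rule: rigid_word.induct) (auto simp: less_Suc_eq)

lemma rigid_word_positions: "rigid_word d w e P \<Longrightarrow> P \<subseteq> {..<length w}"
  by (induction rule: rigid_word.induct) auto

lemma rigid_word_card: "rigid_word d w e P \<Longrightarrow> card P = e - d"
proof (induction rule: rigid_word.induct)
  case (new w e P)
  then have "finite P" "length w \<notin> P"
    using rigid_word_positions[OF new.hyps] finite_subset by auto
  then show ?case using new rigid_word_le[OF new.hyps] by simp
qed auto

lemma rigid_word_le_length:
  assumes "rigid_word d w e P"
  shows "e \<le> d + length w"
proof -
  have "card P \<le> length w"
    using card_mono[OF _ rigid_word_positions[OF assms]] by simp
  then show ?thesis using rigid_word_card[OF assms] by simp
qed

lemma rigid_word_snocE:
  assumes "rigid_word d (w @ [x]) e P"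
  obtains (old) "x < e" "length w \<notin> P" "rigid_word d w e P"
  | (new) "e = Suc x" "length w \<in> P" "rigid_word d w x (P - {length w})"
  using assms
proof (cases rule: rigid_word.cases)
  case (old w' y)
  then show ?thesis using rigid_word_positions that(1) by blast
next
  case (new w' e' P')
  moreover from this have "length w' \<notin> P'" using rigid_word_positions by blast
  ultimately show ?thesis using that(2) by simp
qed auto

lemma rigid_word_append_old:
  assumes "rigid_word d w e P" "set v \<subseteq> {..<e}"
  shows "rigid_word d (w @ v) e P"
  using assms(2)
proof (induction v rule: rev_induct)
  case (snoc x v)
  then show ?case using rigid_word.old[of d "w @ v" e P x] by simp
qed (use assms(1) in simp)

text \<open>
  The word \<open>G i\<close> is the part of the parameter word \<open>G M\<close> that precedes the first occurrence of the
  parameter of index \<open>i\<close>. A rigid word of length \<open>i \<le> M\<close> can be substituted into \<open>G i\<close>, so that words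
  of all lengths up to \<open>M\<close> have an instance.
\<close>

definition prefix_chain :: "nat \<Rightarrow> nat \<Rightarrow> (nat \<Rightarrow> nat list) \<Rightarrow> bool" where
  "prefix_chain d M G \<longleftrightarrow> set (G 0) \<subseteq> {..<d} \<and>
     (\<forall>i<M. \<exists>v. G (Suc i) = G i @ (d + i) # v \<and> set v \<subseteq> {..<Suc (d + i)})"

lemma prefix_chain_set:
  assumes "prefix_chain d M G" "i \<le> M"
  shows "set (G i) \<subseteq> {..<d + i}"
  using assms(2)
proof (induction i)
  case 0
  then show ?case using assms(1) by (auto simp: prefix_chain_def)
next
  case (Suc i)
  then obtain v where "G (Suc i) = G i @ (d + i) # v" "set v \<subseteq> {..<Suc (d + i)}"
    using assms(1) unfolding prefix_chain_def by (meson Suc_le_lessD)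
  then show ?case using Suc by auto
qed

lemma prefix_chain_params:
  assumes "prefix_chain d M G" "i \<le> M"
  shows "{d..<d + i} \<subseteq> set (G i)"
  using assms(2)
proof (induction i)
  case (Suc i)
  then obtain v where "G (Suc i) = G i @ (d + i) # v"
    using assms(1) unfolding prefix_chain_def by (meson Suc_le_lessD)
  then show ?case using Suc by (auto simp: less_Suc_eq)
qed simp

lemma prefix_chain_length_mono:
  assumes "prefix_chain d M G" "i \<le> j" "j \<le> M"
  shows "length (G i) \<le> length (G j)"
  using assms(2,3)
proof (induction j rule: dec_induct)
  case (step j)
  then obtain v where "G (Suc j) = G j @ (d + j) # v"
    using assms(1) unfolding prefix_chain_def by (meson Suc_le_lessD)
  then show ?case using step by simp
qed simp

text \<open>
  A letter of \<open>f\<close> at position \<open>p\<close> is inserted into the chain at the first occurrence of the parameter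
  of index \<open>p\<close>, which is at position \<open>length (G p)\<close>; whatever follows consists of older letters.
\<close>

lemma plug_prefix_chain:
  assumes "prefix_chain d M G" "rigid_word d f e P" "length f \<le> M"
  shows "rigid_word d (plug d f (G (length f))) e ((\<lambda>p. length (G p)) ` P)"
  using assms(2,3)
proof (induction rule: rigid_word.induct)
  case Nil
  have G0: "set (G 0) \<subseteq> {..<d}" using assms(1) by (simp add: prefix_chain_def)
  then have "plug d [] (G 0) = G 0" by (auto simp: plug_def intro!: map_idI)
  then show ?case using rigid_word_append_old[OF rigid_word.Nil G0] by simp
next
  case (old w e P x)
  let ?i = "length w"
  obtain v where v: "G (Suc ?i) = G ?i @ (d + ?i) # v" "set v \<subseteq> {..<Suc (d + ?i)}"
    using assms(1) old.prems unfolding prefix_chain_def by (auto simp: Suc_le_eq)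
  have Gi: "set (G ?i) \<subseteq> {..<d + ?i}" using prefix_chain_set[OF assms(1)] old.prems by simp
  have eq: "plug d (w @ [x]) (G (Suc ?i)) = plug d w (G ?i) @ x # plug d (w @ [x]) v"
    unfolding v plug_append plug_cong_prefix[OF Gi] by (simp add: plug_def nth_append)
  have "set (plug d (w @ [x]) v) \<subseteq> {..<e}"
    using old.hyps v(2) rigid_word_set[OF old.hyps(1)] rigid_word_le[OF old.hyps(1)]
    by (intro set_plug_subset) auto
  then have "rigid_word d (plug d w (G ?i) @ (x # plug d (w @ [x]) v)) e ((\<lambda>p. length (G p)) ` P)"
    using old by (intro rigid_word_append_old) auto
  then show ?case using eq by simp
next
  case (new w e P)
  let ?i = "length w"
  obtain v where v: "G (Suc ?i) = G ?i @ (d + ?i) # v" "set v \<subseteq> {..<Suc (d + ?i)}"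
    using assms(1) new.prems unfolding prefix_chain_def by (auto simp: Suc_le_eq)
  have Gi: "set (G ?i) \<subseteq> {..<d + ?i}" using prefix_chain_set[OF assms(1)] new.prems by simp
  have eq: "plug d (w @ [e]) (G (Suc ?i)) = (plug d w (G ?i) @ [e]) @ plug d (w @ [e]) v"
    unfolding v plug_append plug_cong_prefix[OF Gi] by (simp add: plug_def nth_append)
  have "set (plug d (w @ [e]) v) \<subseteq> {..<Suc e}"
    using v(2) rigid_word_set[OF new.hyps] rigid_word_le[OF new.hyps]
    by (intro set_plug_subset) auto
  moreover have "rigid_word d (plug d w (G ?i) @ [e]) (Suc e)
      (insert (length (plug d w (G ?i))) ((\<lambda>p. length (G p)) ` P))"
    using new by (intro rigid_word.new) auto
  ultimately have "rigid_word d ((plug d w (G ?i) @ [e]) @ plug d (w @ [e]) v) (Suc e)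
      (insert (length (plug d w (G ?i))) ((\<lambda>p. length (G p)) ` P))"
    by (rule rigid_word_append_old[rotated])
  then show ?case unfolding length_append_singleton eq by simp
qed

section \<open>Colourings depending only on the positions of first occurrences\<close>

definition canonical_number :: "nat \<Rightarrow> nat \<Rightarrow> nat \<Rightarrow> nat \<Rightarrow> bool" where
  "canonical_number d M r N \<longleftrightarrow> (\<forall>\<chi> :: nat list \<Rightarrow> nat. (\<forall>w. \<chi> w < r) \<longrightarrow>
     (\<exists>G. prefix_chain d M G \<and> length (G M) = N \<and>
       (\<forall>f f' e P. rigid_word d f e P \<longrightarrow> rigid_word d f' e P \<longrightarrow>
          length f = length f' \<longrightarrow> length f \<le> M \<longrightarrow>
          \<chi> (plug d f (G (length f))) = \<chi> (plug d f' (G (length f'))))))"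

text \<open>
  The chain is prolonged by one parameter at a time. In an instance the next letter is either
  the next parameter, which changes the set of first occurrences, or it repeats an older letter, and
  then the colour must not depend on which one. A Hales-Jewett line over the alphabet of all
  positions of the word constructed so far achieves this for all instances of that word at once,
  since every older letter is a constant or occurs at one of these positions.
\<close>

theorem canonical_chain: "\<exists>N. canonical_number d M r N"
proof (induction M arbitrary: r)
  case 0
  have "canonical_number d 0 r 0"
    unfolding canonical_number_def prefix_chain_def
    by (intro allI impI exI[of _ "\<lambda>_. []"]) auto
  then show ?case ..
next
  case (Suc M)
  let ?I = "{..d + M + 2}"
  obtain s :: nat where s: "\<And>F :: nat list \<Rightarrow> nat \<Rightarrow> nat. (\<And>w i. i \<in> ?I \<Longrightarrow> F w i < r) \<Longrightarrow>
    \<exists>c. (\<forall>w. c w < s) \<and> (\<forall>w w'. c w = c w' \<longrightarrow> (\<forall>i\<in>?I. F w i = F w' i))"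
    by (rule finite_family_coding[of ?I r, where ?'a = "nat list"]) blast+
  obtain N1 where N1: "canonical_number d M s N1" using Suc.IH by blast
  \<comment> \<open>A letter below \<open>t\<close> stands for a constant (if below \<open>d\<close>) or for a position in the chain built so far.\<close>
  define t where "t = d + N1"
  define W where "W = {w :: nat list. length w = N1 \<and> set w \<subseteq> {..<d + M}}"
  have "finite W" unfolding W_def by (rule finite_words)
  then obtain R :: nat where R: "\<And>F :: nat list \<Rightarrow> nat list \<Rightarrow> nat.
    (\<And>v w. w \<in> W \<Longrightarrow> F v w < r) \<Longrightarrow>
    \<exists>c. (\<forall>v. c v < R) \<and> (\<forall>v v'. c v = c v' \<longrightarrow> (\<forall>w\<in>W. F v w = F v' w))"
    by (rule finite_family_coding[of W r, where ?'a = "nat list"]) blast+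
  obtain N2 where N2: "hales_jewett_number t R N2" using hales_jewett by blast
  have "canonical_number d (Suc M) r (N1 + N2)"
    unfolding canonical_number_def
  proof (intro allI impI)
    fix \<chi> :: "nat list \<Rightarrow> nat"
    assume chi: "\<forall>w. \<chi> w < r"
    \<comment> \<open>The letter that \<open>w\<close> has at the place denoted by \<open>k\<close>.\<close>
    define pos where "pos w k = ([0..<d] @ w) ! k" for w k
    obtain c0 where c0: "\<forall>v. c0 v < R"
      "\<forall>v v'. c0 v = c0 v' \<longrightarrow> (\<forall>w\<in>W. \<chi> (w @ map (pos w) v) = \<chi> (w @ map (pos w) v'))"
      using R[of "\<lambda>v w. \<chi> (w @ map (pos w) v)", OF spec[OF chi]] by blast
    obtain h where h: "length h = N2" "set h \<subseteq> {..t}" "t \<in> set h"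
      "\<And>k k'. k < t \<Longrightarrow> k' < t \<Longrightarrow> c0 (inst t k h) = c0 (inst t k' h)"
      using N2 c0(1) unfolding hales_jewett_number_def by blast
    define ext where "ext w y v = map (\<lambda>x. if x = t then y else pos w x) v" for w y v
    have ext_append: "ext w y (a @ t # b) = ext w y a @ y # ext w y b" for w y a b
      by (simp add: ext_def)
    have line: "\<chi> (w @ ext w (pos w k) h) = \<chi> (w @ ext w (pos w k') h)"
      if "w \<in> W" "k < t" "k' < t" for w k k'
    proof -
      have "map (pos w) (inst t k h) = ext w (pos w k) h" for k
        by (auto simp: inst_def ext_def)
      then show ?thesis using c0(2) h(4)[OF that(2,3)] that(1) by metis
    qed
    obtain c v where hc: "h = c @ t # v" "t \<notin> set c"
      using split_list_first[OF h(3)] by blast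
    have c_lt: "x < t" if "x \<in> set c" for x
      using that h(2) hc by (metis UnCI atMost_iff le_neq_implies_less set_append subset_iff)
    have v_le: "x \<le> t" if "x \<in> set v" for x
      using that h(2) hc by auto
    \<comment> \<open>The colours of all continuations of \<open>w\<close> that are needed: \<open>w\<close> itself, \<open>w\<close> up to the new parameter,
      and \<open>w\<close> followed by the whole line with the letter \<open>i - 2\<close> in place of its variable.\<close>
    define F where "F w i = (if i = 0 then \<chi> w else if i = 1 then \<chi> (w @ map (pos w) c)
      else \<chi> (w @ ext w (i - 2) h))" for w i
    have F_lt: "F w i < r" for w i unfolding F_def using chi by simp
    obtain c' where c': "\<forall>w. c' w < s"
      "\<forall>w w'. c' w = c' w' \<longrightarrow> (\<forall>i\<in>?I. F w i = F w' i)"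
      using s[of F, OF F_lt] by blast
    obtain G where G: "prefix_chain d M G" "length (G M) = N1"
      and G_same: "\<And>f f' e P. rigid_word d f e P \<Longrightarrow> rigid_word d f' e P \<Longrightarrow>
          length f = length f' \<Longrightarrow> length f \<le> M \<Longrightarrow>
          c' (plug d f (G (length f))) = c' (plug d f' (G (length f')))"
      using N1 c'(1) unfolding canonical_number_def by blast
    have F_same: "F (plug d f (G (length f))) i = F (plug d f' (G (length f'))) i"
      if "rigid_word d f e P" "rigid_word d f' e P" "length f = length f'" "length f \<le> M"
        "i \<le> d + M + 2" for f f' e P i
      using G_same[OF that(1-4)] c'(2) that(5) by blast
    let ?g = "G M"
    have GM: "set ?g \<subseteq> {..<d + M}" using prefix_chain_set[OF G(1)] by blast
    have pos_lt: "pos ?g k < d + M" if "k < t" for k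
    proof -
      have "pos ?g k \<in> set ([0..<d] @ ?g)"
        unfolding pos_def using that G(2) t_def by (intro nth_mem) simp
      then show ?thesis using GM by auto
    qed
    \<comment> \<open>The constant segment \<open>c\<close> before the first occurrence of the variable belongs to the prefix of index \<open>M\<close>.\<close>
    define G' where "G' i = (if i < M then G i else if i = M then ?g @ map (pos ?g) c
      else ?g @ map (pos ?g) c @ (d + M) # ext ?g (d + M) v)" for i
    have chain: "prefix_chain d (Suc M) G'"
      unfolding prefix_chain_def
    proof (intro conjI allI impI)
      show "set (G' 0) \<subseteq> {..<d}"
        using G(1) pos_lt c_lt unfolding G'_def prefix_chain_def by auto
      fix i assume "i < Suc M"
      then consider "i = M" | "Suc i = M" | "Suc i < M" by linarith
      then show "\<exists>v. G' (Suc i) = G' i @ (d + i) # v \<and> set v \<subseteq> {..<Suc (d + i)}"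
      proof cases
        case 1
        have "set (ext ?g (d + M) v) \<subseteq> {..<Suc (d + M)}"
          unfolding ext_def using pos_lt v_le by (fastforce simp: less_Suc_eq le_less)
        then show ?thesis using 1 by (simp add: G'_def)
      next
        case 2
        then obtain u where "G (Suc i) = G i @ (d + i) # u" "set u \<subseteq> {..<Suc (d + i)}"
          using G(1) unfolding prefix_chain_def by (metis lessI)
        moreover have "set (map (pos ?g) c) \<subseteq> {..<Suc (d + i)}"
          using pos_lt c_lt 2 by auto
        ultimately show ?thesis using 2 by (intro exI[of _ "u @ map (pos ?g) c"]) (auto simp: G'_def)
      next
        case 3
        then show ?thesis using G(1) unfolding prefix_chain_def by (auto simp: G'_def)
      qed
    qed
    have len: "length (G' (Suc M)) = N1 + N2"
      unfolding G'_def ext_def using G(2) h(1) hc(1) by simp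
    have pos_plug: "pos (plug d f ?g) k = (if pos ?g k < d then pos ?g k else f ! (pos ?g k - d))"
      if "length f = M" "k < t" for f k
      using that G(2) unfolding pos_def t_def plug_def by (auto simp: nth_append)
    have plugM: "plug d f (G' M) = plug d f ?g @ map (pos (plug d f ?g)) c" if "length f = M" for f
      unfolding G'_def using c_lt pos_plug[OF that] by (simp add: plug_def[of d f "map _ _"])
    have plugSuc: "plug d (f @ [x]) (G' (Suc M)) = plug d f ?g @ ext (plug d f ?g) x h"
      if "length f = M" for f x
    proof -
      have 1: "plug d (f @ [x]) ?g = plug d f ?g"
        using plug_cong_prefix GM that by simp
      have l: "(if pos ?g k < d then pos ?g k else (f @ [x]) ! (pos ?g k - d)) = pos (plug d f ?g) k"
        if "k < t" for k
        using pos_plug[OF \<open>length f = M\<close> that] pos_lt[OF that] \<open>length f = M\<close> by (auto simp: nth_append)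
      have 2: "plug d (f @ [x]) (map (pos ?g) c) = ext (plug d f ?g) x c"
        unfolding ext_def plug_def[of d "f @ [x]" "map _ _"] map_map
        using l c_lt hc(2) by (intro map_cong refl) auto
      have 3: "plug d (f @ [x]) (ext ?g (d + M) v) = ext (plug d f ?g) x v"
        unfolding ext_def plug_def[of d "f @ [x]" "map _ _"] map_map
      proof (intro map_cong refl)
        fix k assume "k \<in> set v"
        then show "((\<lambda>x'. if x' < d then x' else (f @ [x]) ! (x' - d)) \<circ>
            (\<lambda>x'. if x' = t then d + M else pos ?g x')) k = (if k = t then x else pos (plug d f ?g) k)"
        proof (cases "k = t")
          case True
          then show ?thesis using that by (simp add: nth_append)
        next
          case False
          then have "k < t" using v_le[OF \<open>k \<in> set v\<close>] by simp
          then show ?thesis using l[of k] False by (simp only: o_apply if_False)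
        qed
      qed
      show ?thesis
        using 1 2 3 that by (simp add: G'_def hc(1) ext_append plug_Cons nth_append)
    qed
    have old_letter: "\<exists>k<t. pos (plug d f ?g) k = x"
      if f: "rigid_word d f e P" "length f = M" and "x < e" for f e P x
    proof (cases "x < d")
      case True
      then show ?thesis unfolding t_def pos_def by (intro exI[of _ x]) (simp add: nth_append)
    next
      case False
      then have "x \<in> set f" using rigid_word_surj[OF f(1)] \<open>x < e\<close> by auto
      then obtain p where p: "p < M" "f ! p = x" using f(2) by (metis in_set_conv_nth)
      then have "d + p \<in> set ?g" using prefix_chain_params[OF G(1), of M] by auto
      then obtain q where q: "q < N1" "?g ! q = d + p" using G(2) by (metis in_set_conv_nth)
      then show ?thesis
        using p G(2) unfolding t_def pos_def plug_def by (intro exI[of _ "d + q"]) (simp add: nth_append)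
    qed
    have inW: "plug d f ?g \<in> W" if "rigid_word d f e P" "length f = M" for f e P
    proof -
      have "set f \<subseteq> {..<d + M}"
        using rigid_word_set[OF that(1)] rigid_word_le_length[OF that(1)] that(2) by auto
      then have "set (plug d f ?g) \<subseteq> {..<d + M}"
        using GM that(2) by (intro set_plug_subset) auto
      then show ?thesis unfolding W_def using G(2) by simp
    qed
    have same: "\<chi> (plug d f (G' (length f))) = \<chi> (plug d f' (G' (length f')))"
      if f: "rigid_word d f e P" and f': "rigid_word d f' e P"
        and ll: "length f = length f'" and le: "length f \<le> Suc M" for f f' e P
    proof -
      consider "length f < M" | "length f = M" | "length f = Suc M" using le by linarith
      then show ?thesis
      proof cases
        case 1
        then show ?thesis using F_same[OF f f' ll, of 0] ll by (simp add: G'_def F_def)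
      next
        case 2
        then show ?thesis using F_same[OF f f' ll, of 1] ll plugM[of f] plugM[of f'] by (simp add: F_def)
      next
        case 3
        obtain a x where a: "f = a @ [x]" "length a = M" using 3 by (metis length_Suc_conv_rev)
        obtain b y where b: "f' = b @ [y]" "length b = M" using 3 ll by (metis length_Suc_conv_rev)
        let ?w = "plug d a ?g" and ?w' = "plug d b ?g"
        have goal: ?thesis if "\<chi> (?w @ ext ?w x h) = \<chi> (?w' @ ext ?w' y h)"
          using that plugSuc a b by simp
        have use_F: "\<chi> (?w @ ext ?w z h) = \<chi> (?w' @ ext ?w' z h)"
          if "rigid_word d a e' P'" "rigid_word d b e' P'" "z \<le> e'" for e' P' z
        proof -
          have "z \<le> d + M" using that(3) rigid_word_le_length[OF that(1)] a(2) by simp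
          then show ?thesis using F_same[OF that(1,2), of "z + 2"] a(2) b(2) by (simp add: F_def)
        qed
        from f[unfolded a(1)] show ?thesis
        proof (cases rule: rigid_word_snocE)
          case old
          have b': "rigid_word d b e P" "y < e"
            using f'[unfolded b(1)] old(2) a(2) b(2) by (auto elim: rigid_word_snocE)
          obtain k k' where "k < t" "k' < t" "pos ?w' k = x" "pos ?w' k' = y"
            using old_letter[OF b'(1) b(2)] old(1) b'(2) by blast
          then have "\<chi> (?w' @ ext ?w' x h) = \<chi> (?w' @ ext ?w' y h)"
            using line[OF inW[OF b'(1) b(2)]] by metis
          then show ?thesis using use_F[OF old(3) b'(1)] old(1) goal by simp
        next
          case new
          have b': "rigid_word d b x (P - {length a})" "y = x"
            using f'[unfolded b(1)] new(1,2) a(2) b(2) by (auto elim: rigid_word_snocE)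
          show ?thesis using use_F[OF new(3) b'(1)] b'(2) goal by simp
        qed
      qed
    qed
    show "\<exists>G. prefix_chain d (Suc M) G \<and> length (G (Suc M)) = N1 + N2 \<and>
       (\<forall>f f' e P. rigid_word d f e P \<longrightarrow> rigid_word d f' e P \<longrightarrow>
          length f = length f' \<longrightarrow> length f \<le> Suc M \<longrightarrow>
          \<chi> (plug d f (G (length f))) = \<chi> (plug d f' (G (length f'))))"
      using chain len same by (intro exI[of _ G']) blast
  qed
  then show ?case ..
qed

section \<open>The Graham-Rothschild theorem\<close>

text \<open>
  The same class of words as \<open>rigid_word\<close>, without reference to a construction: only smaller letters
  precede some occurrence of the parameter \<open>i\<close>, which is then its first one.
\<close>

definition rigid :: "nat \<Rightarrow> nat \<Rightarrow> nat list \<Rightarrow> bool" where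
  "rigid d e w \<longleftrightarrow> d \<le> e \<and> set w \<subseteq> {..<e} \<and>
     (\<forall>i\<in>{d..<e}. \<exists>b<length w. w ! b = i \<and> (\<forall>c<b. w ! c < i))"

lemma rigid_snoc_old:
  assumes "rigid d e w" "x < e"
  shows "rigid d e (w @ [x])"
proof -
  have "\<exists>b<length (w @ [x]). (w @ [x]) ! b = i \<and> (\<forall>c<b. (w @ [x]) ! c < i)"
    if i: "i \<in> {d..<e}" for i
  proof -
    obtain b where "b < length w" "w ! b = i" "\<forall>c<b. w ! c < i"
      using assms(1) i unfolding rigid_def by blast
    then show ?thesis by (intro exI[of _ b]) (simp add: nth_append)
  qed
  then show ?thesis using assms unfolding rigid_def by simp
qed

lemma rigid_snoc_new: "rigid d e w \<Longrightarrow> rigid d (Suc e) (w @ [e])"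
proof -
  assume w: "rigid d e w"
  have "\<exists>b<length (w @ [e]). (w @ [e]) ! b = i \<and> (\<forall>c<b. (w @ [e]) ! c < i)"
    if i: "i \<in> {d..<Suc e}" for i
  proof (cases "i = e")
    case True
    have "\<forall>c<length w. w ! c < e" using w unfolding rigid_def by (meson lessThan_iff nth_mem subset_iff)
    then show ?thesis using True by (intro exI[of _ "length w"]) (simp add: nth_append)
  next
    case False
    then have "i \<in> {d..<e}" using i by auto
    then obtain b where "b < length w" "w ! b = i" "\<forall>c<b. w ! c < i"
      using w unfolding rigid_def by blast
    then show ?thesis by (intro exI[of _ b]) (simp add: nth_append)
  qed
  then show ?thesis using w unfolding rigid_def by (auto simp: less_Suc_eq)
qed

lemma rigid_iff_rigid_word: "rigid d e w \<longleftrightarrow> (\<exists>P. rigid_word d w e P)"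
proof
  show "\<exists>P. rigid_word d w e P" if "rigid d e w"
    using that
  proof (induction w arbitrary: e rule: rev_induct)
    case Nil
    then have "e = d" unfolding rigid_def by force
    then show ?case using rigid_word.Nil by blast
  next
    case (snoc x w)
    then have w: "d \<le> e" "set w \<subseteq> {..<e}" "x < e" unfolding rigid_def by auto
    show ?case
    proof (cases "rigid d e w")
      case True
      then show ?thesis using snoc.IH w(3) rigid_word.old by blast
    next
      case False
      then obtain i where i: "i \<in> {d..<e}" "\<not> (\<exists>b<length w. w ! b = i \<and> (\<forall>c<b. w ! c < i))"
        using w unfolding rigid_def by blast
      have first: "\<exists>b<Suc (length w). (w @ [x]) ! b = i' \<and> (\<forall>c<b. (w @ [x]) ! c < i')"
        if "i' \<in> {d..<e}" for i'
        using snoc.prems that unfolding rigid_def by simp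
      obtain b where b: "b < Suc (length w)" "(w @ [x]) ! b = i" "\<forall>c<b. (w @ [x]) ! c < i"
        using first[OF i(1)] by blast
      have "b = length w"
      proof (rule ccontr)
        assume "b \<noteq> length w"
        then have "b < length w" using b(1) by simp
        then show False using i(2) b(2,3) by (force simp: nth_append)
      qed
      then have x: "x = i" and small: "\<forall>c<length w. w ! c < i"
        using b(2,3) by (auto simp: nth_append)
      have early: "\<exists>b<length w. w ! b = i' \<and> (\<forall>c<b. w ! c < i')"
        if i': "i' \<in> {d..<e}" "i' \<noteq> i" for i'
      proof -
        obtain b where b: "b < Suc (length w)" "(w @ [x]) ! b = i'" "\<forall>c<b. (w @ [x]) ! c < i'"
          using first[OF i'(1)] by blast
        then have "b < length w" using i'(2) x by (auto simp: less_Suc_eq)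
        then show ?thesis using b by (intro exI[of _ b]) (auto simp: nth_append)
      qed
      have e: "e = Suc i"
      proof (rule ccontr)
        assume "e \<noteq> Suc i"
        then have "Suc i \<in> {d..<e}" using i(1) by auto
        then show False using early[of "Suc i"] small by force
      qed
      have "rigid d i w"
        unfolding rigid_def using i(1) small early e by (auto simp: set_conv_nth)
      then show ?thesis using snoc.IH rigid_word.new x e by blast
    qed
  qed
  show "rigid d e w" if "\<exists>P. rigid_word d w e P"
  proof -
    from that obtain P where "rigid_word d w e P" ..
    then show ?thesis
    proof (induction rule: rigid_word.induct)
      case Nil
      then show ?case by (simp add: rigid_def)
    qed (auto intro: rigid_snoc_old rigid_snoc_new)
  qed
qed

lemma rigid_upt: "rigid d (d + m) [d..<d + m]"
proof -
  have "\<exists>b<length [d..<d + m]. [d..<d + m] ! b = i \<and> (\<forall>c<b. [d..<d + m] ! c < i)"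
    if "i \<in> {d..<d + m}" for i
    using that by (intro exI[of _ "i - d"]) auto
  then show ?thesis unfolding rigid_def by auto
qed

lemma plug_upt: "set w \<subseteq> {..<d + m} \<Longrightarrow> plug d [d..<d + m] w = w"
  unfolding plug_def by (rule map_idI) (auto simp: subset_iff)

lemma plug_plug:
  assumes "set w \<subseteq> {..<d + length k}"
  shows "plug d f (plug d k w) = plug d (plug d f k) w"
  unfolding plug_def using assms by (auto simp: subset_iff)

text \<open>
  The parameter of index \<open>i\<close> at position \<open>q i\<close> and the constant \<open>0\<close> elsewhere: substituting this word
  moves first occurrences to positions in the range of \<open>q\<close>.
\<close>

primrec spaced_chain :: "nat \<Rightarrow> (nat \<Rightarrow> nat) \<Rightarrow> nat \<Rightarrow> nat list" where
  "spaced_chain d q 0 = replicate (q 0) 0"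
| "spaced_chain d q (Suc i) =
     spaced_chain d q i @ (d + i) # replicate (q (Suc i) - Suc (q i)) 0"

lemma prefix_chain_spaced_chain: "d > 0 \<Longrightarrow> prefix_chain d m (spaced_chain d q)"
  unfolding prefix_chain_def by auto

lemma length_spaced_chain:
  assumes "\<And>i. i < m \<Longrightarrow> q i < q (Suc i)" "i \<le> m"
  shows "length (spaced_chain d q i) = q i"
  using assms(2)
proof (induction i)
  case (Suc i)
  then show ?case using assms(1)[of i] by simp
qed simp

text \<open>
  For a chain as in \<open>canonical_chain\<close> the colour of a rigid word with \<open>n\<close> parameters is a function of
  \<open>n + 1\<close> numbers, namely the positions of the first occurrences and, above them, the length. Ramsey's
  theorem gives \<open>m + 1\<close> numbers among which this function is constant; the least \<open>m\<close> of them carry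
  the parameters of the desired word and the greatest one is its length. At least one
  constant is required to fill the remaining places.
\<close>

lemma graham_rothschild_pos:
  assumes "d > 0"
  shows "\<exists>N. \<forall>\<chi> :: nat list \<Rightarrow> nat. (\<forall>w. \<chi> w < r) \<longrightarrow>
    (\<exists>g. length g = N \<and> rigid d (d + m) g \<and>
      (\<forall>f f'. length f = m \<longrightarrow> length f' = m \<longrightarrow> rigid d (d + n) f \<longrightarrow> rigid d (d + n) f' \<longrightarrow>
        \<chi> (plug d f g) = \<chi> (plug d f' g)))"
proof -
  obtain K :: nat where K: "partn_lst {..<K} (replicate r (Suc m)) (Suc n)"
    using ramsey_full by blast
  obtain N where N: "canonical_number d K r N" using canonical_chain by blast
  show ?thesis
  proof (intro exI[of _ N] allI impI)
    fix \<chi> :: "nat list \<Rightarrow> nat"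
    assume chi: "\<forall>w. \<chi> w < r"
    \<comment> \<open>The words in a chain have various lengths; the constant \<open>0\<close>, which every substitution fixes, makes them equally long.\<close>
    define pad where "pad w = w @ replicate (N - length w) 0" for w :: "nat list"
    obtain G where G: "prefix_chain d K G" "length (G K) = N"
      and G_same: "\<And>f f' e P. rigid_word d f e P \<Longrightarrow> rigid_word d f' e P \<Longrightarrow>
          length f = length f' \<Longrightarrow> length f \<le> K \<Longrightarrow>
          \<chi> (pad (plug d f (G (length f)))) = \<chi> (pad (plug d f' (G (length f'))))"
      using N[unfolded canonical_number_def, rule_format, of "\<lambda>w. \<chi> (pad w)"] chi by blast
    \<comment> \<open>The words whose canonical data are \<open>X\<close>, with \<open>Max X\<close> in the role of the length.\<close>
    define Q where "Q X f \<longleftrightarrow> length f = Max X \<and> rigid_word d f (d + n) (X - {Max X})" for X f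
    define col where "col X = (if \<exists>f. Q X f then \<chi> (pad (plug d (SOME f. Q X f) (G (Max X)))) else 0)" for X
    have "0 < r" using chi[rule_format, of "[]"] by simp
    then have "col X < r" for X unfolding col_def using chi by simp
    then have "col \<in> [{..<K}]\<^bsup>Suc n\<^esup> \<rightarrow> {..<r}" by blast
    then obtain i H where i: "i < length (replicate r (Suc m))" and
      H: "H \<in> nsets {..<K} (replicate r (Suc m) ! i)" "col ` [H]\<^bsup>Suc n\<^esup> \<subseteq> {i}"
      using partn_lstE[OF K] by (metis length_replicate)
    have H': "H \<subseteq> {..<K}" "finite H" "card H = Suc m"
      using H(1) i by (auto simp: nsets_def)
    define q where "q j = sorted_list_of_set H ! j" for j
    have q_mem: "q j \<in> H" if "j \<le> m" for j
      using that H'(2,3) nth_mem[of j "sorted_list_of_set H"] unfolding q_def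
      by (simp add: less_Suc_eq_le)
    have q_less: "q j < q j'" if "j < j'" "j' \<le> m" for j j'
      unfolding q_def using that H'(2,3) strict_sorted_list_of_set[of H]
      by (intro sorted_wrt_nth_less[of "(<)"]) auto
    have q_K: "q j \<le> K" if "j \<le> m" for j using q_mem[OF that] H'(1) by auto
    define k where "k = spaced_chain d q"
    have k: "prefix_chain d m k" unfolding k_def using prefix_chain_spaced_chain[OF assms] .
    have len_k: "length (k j) = q j" if "j \<le> m" for j
      unfolding k_def using length_spaced_chain[of m q j d] q_less that by simp
    define g0 where "g0 = plug d (k m) (G (q m))"
    have set_G: "set (G (q m)) \<subseteq> {..<d + length (k m)}"
      using prefix_chain_set[OF G(1) q_K[of m]] len_k by simp
    have len_g0: "length g0 \<le> N"
      unfolding g0_def using prefix_chain_length_mono[OF G(1) q_K[of m] order_refl] G(2) by simp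
    have "\<exists>P. rigid_word d (k m) (d + m) P"
    proof -
      obtain P where P: "rigid_word d [d..<d + m] (d + m) P"
        using rigid_upt rigid_iff_rigid_word by blast
      have "plug d [d..<d + m] (k m) = k m"
        using plug_upt prefix_chain_set[OF k] by blast
      then show ?thesis using plug_prefix_chain[OF k P] by auto
    qed
    then obtain P' where P': "rigid_word d (k m) (d + m) P'" ..
    have "\<exists>P. rigid_word d g0 (d + m) P"
      unfolding g0_def using plug_prefix_chain[OF G(1) P'] len_k q_K by auto
    moreover have "set (replicate (N - length g0) 0) \<subseteq> {..<d + m}" using assms by auto
    ultimately have "\<exists>P. rigid_word d (pad g0) (d + m) P"
      unfolding pad_def using rigid_word_append_old by blast
    then have rigid_g: "rigid d (d + m) (pad g0)" using rigid_iff_rigid_word by blast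
    have col_i: "\<chi> (plug d f (pad g0)) = i" if f: "length f = m" "rigid d (d + n) f" for f
    proof -
      obtain P where P: "rigid_word d f (d + n) P" using f(2) rigid_iff_rigid_word by blast
      define f1 where "f1 = plug d f (k m)"
      have Pm: "P \<subseteq> {..<m}" using rigid_word_positions[OF P] f(1) by simp
      then have fin: "finite P" using finite_subset by blast
      have "(\<lambda>p. length (k p)) ` P = q ` P"
        using len_k Pm by (intro image_cong) auto
      then have f1: "length f1 = q m" "rigid_word d f1 (d + n) (q ` P)"
        unfolding f1_def using plug_prefix_chain[OF k P] f(1) len_k by auto
      define X where "X = insert (q m) (q ` P)"
      have lt: "x < q m" if "x \<in> q ` P" for x using that q_less Pm by auto
      have Max: "Max X = q m" unfolding X_def using lt fin by (intro Max_eqI) (auto dest: less_imp_le)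
      have X': "X - {q m} = q ` P" unfolding X_def using lt by blast
      have "inj_on q P"
        using q_less Pm by (intro linorder_inj_onI') (metis lessThan_iff less_imp_le less_irrefl subset_iff)
      then have "card (q ` P) = n" using rigid_word_card[OF P] by (simp add: card_image)
      then have "card X = Suc n" unfolding X_def using lt fin by (subst card_insert_disjoint) auto
      moreover have "X \<subseteq> H" unfolding X_def using q_mem Pm by (auto dest: less_imp_le)
      ultimately have "X \<in> [H]\<^bsup>Suc n\<^esup>" unfolding nsets_def X_def using fin by simp
      then have "col X = i" using H(2) by blast
      have Qf1: "Q X f1" unfolding Q_def Max X' using f1 by simp
      then have "Q X (SOME f. Q X f)" by (rule someI)
      then have "\<chi> (pad (plug d (SOME f. Q X f) (G (q m)))) = \<chi> (pad (plug d f1 (G (q m))))"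
        using G_same[of "SOME f. Q X f" "d + n" "q ` P" f1] f1 q_K[of m] unfolding Q_def Max X' by simp
      then have "col X = \<chi> (pad (plug d f1 (G (q m))))"
        unfolding col_def Max using Qf1 by auto
      moreover have "plug d f (pad g0) = pad (plug d f1 (G (q m)))"
        unfolding pad_def f1_def g0_def using plug_plug[OF set_G] assms
        by (simp add: plug_def[of d f "replicate _ _"])
      ultimately show ?thesis using \<open>col X = i\<close> by simp
    qed
    show "\<exists>g. length g = N \<and> rigid d (d + m) g \<and>
      (\<forall>f f'. length f = m \<longrightarrow> length f' = m \<longrightarrow> rigid d (d + n) f \<longrightarrow> rigid d (d + n) f' \<longrightarrow>
        \<chi> (plug d f g) = \<chi> (plug d f' g))"
      using rigid_g col_i len_g0 by (intro exI[of _ "pad g0"]) (simp add: pad_def)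
  qed
qed

text \<open>
  Without constants a rigid word must start with \<open>0\<close>, and after that \<open>0\<close> may be regarded as a
  constant. This is how the case of an empty alphabet reduces to \<open>graham_rothschild_pos\<close>.
\<close>

lemma rigid_Cons_zero: "rigid 0 (Suc e) (x # w) \<longleftrightarrow> x = 0 \<and> rigid 1 (Suc e) w"
proof
  assume l: "rigid 0 (Suc e) (x # w)"
  have first: "\<exists>b<Suc (length w). (x # w) ! b = i \<and> (\<forall>c<b. (x # w) ! c < i)" if "i < Suc e" for i
    using l that unfolding rigid_def by simp
  have x: "x = 0"
  proof -
    obtain b where b: "(x # w) ! b = 0" "\<forall>c<b. (x # w) ! c < 0" using first[of 0] by blast
    then have "b = 0" by auto
    then show ?thesis using b(1) by simp
  qed
  have "\<exists>b<length w. w ! b = i \<and> (\<forall>c<b. w ! c < i)" if "i \<in> {1..<Suc e}" for i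
  proof -
    obtain b where b: "b < Suc (length w)" "(x # w) ! b = i" "\<forall>c<b. (x # w) ! c < i"
      using first[of i] \<open>i \<in> _\<close> by auto
    then obtain b' where b': "b = Suc b'" using x \<open>i \<in> _\<close> by (cases b) auto
    have "w ! c < i" if "c < b'" for c using b(3)[rule_format, of "Suc c"] that b' by simp
    then show ?thesis using b b' by (intro exI[of _ b']) auto
  qed
  then show "x = 0 \<and> rigid 1 (Suc e) w" using x l unfolding rigid_def by auto
next
  assume r: "x = 0 \<and> rigid 1 (Suc e) w"
  have "\<exists>b<length (x # w). (x # w) ! b = i \<and> (\<forall>c<b. (x # w) ! c < i)" if "i < Suc e" for i
  proof (cases "i = 0")
    case True
    then show ?thesis using r by (intro exI[of _ 0]) simp
  next
    case False
    then have "i \<in> {1..<Suc e}" using that by auto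
    then obtain b where "b < length w" "w ! b = i" "\<forall>c<b. w ! c < i"
      using r unfolding rigid_def by blast
    then show ?thesis using r False by (intro exI[of _ "Suc b"]) (auto simp: less_Suc_eq_0_disj)
  qed
  then show "rigid 0 (Suc e) (x # w)" using r unfolding rigid_def by auto
qed

theorem graham_rothschild:
  "\<exists>N. \<forall>\<chi> :: nat list \<Rightarrow> nat. (\<forall>w. \<chi> w < r) \<longrightarrow>
    (\<exists>g. length g = N \<and> rigid d (d + m) g \<and>
      (\<forall>f f'. length f = m \<longrightarrow> length f' = m \<longrightarrow> rigid d (d + n) f \<longrightarrow> rigid d (d + n) f' \<longrightarrow>
        \<chi> (plug d f g) = \<chi> (plug d f' g)))"
proof (cases "d = 0")
  case False
  then show ?thesis using graham_rothschild_pos[of d r m n] by simp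
next
  case True
  show ?thesis
  proof (cases "m = 0 \<or> n = 0")
    case True
    have "f = f'" if "length f = m" "length f' = m" "rigid 0 n f" for f f' :: "nat list"
      using True that by (cases f) (auto simp: rigid_def)
    then show ?thesis
      using \<open>d = 0\<close> rigid_upt[of 0 m] by (intro exI[of _ m] allI impI exI[of _ "[0..<m]"]) auto
  next
    case False
    then obtain m' n' where mn: "m = Suc m'" "n = Suc n'" by (metis old.nat.exhaust)
    obtain N where N: "\<And>\<chi> :: nat list \<Rightarrow> nat. (\<forall>w. \<chi> w < r) \<Longrightarrow>
      (\<exists>g. length g = N \<and> rigid 1 (1 + m') g \<and>
        (\<forall>f f'. length f = m' \<longrightarrow> length f' = m' \<longrightarrow> rigid 1 (1 + n') f \<longrightarrow> rigid 1 (1 + n') f' \<longrightarrow>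
          \<chi> (plug 1 f g) = \<chi> (plug 1 f' g)))"
      using graham_rothschild_pos[of 1 r m' n'] by auto
    show ?thesis
    proof (intro exI[of _ "Suc N"] allI impI)
      fix \<chi> :: "nat list \<Rightarrow> nat"
      assume chi: "\<forall>w. \<chi> w < r"
      then obtain g where g: "length g = N" "rigid 1 (1 + m') g"
        "\<And>f f'. length f = m' \<Longrightarrow> length f' = m' \<Longrightarrow> rigid 1 (1 + n') f \<Longrightarrow> rigid 1 (1 + n') f' \<Longrightarrow>
          \<chi> (0 # plug 1 f g) = \<chi> (0 # plug 1 f' g)"
        using N[of "\<lambda>w. \<chi> (0 # w)"] by blast
      have split: "\<exists>f1. length f1 = m' \<and> rigid 1 (1 + n') f1 \<and> plug 0 f (0 # g) = 0 # plug 1 f1 g"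
        if f: "length f = m" "rigid 0 n f" for f
      proof -
        obtain x f1 where x: "f = x # f1" using f(1) mn by (cases f) auto
        then have "x = 0" "rigid 1 (1 + n') f1" using f(2) mn rigid_Cons_zero by auto
        moreover have "plug 0 f (0 # g) = 0 # plug 1 f1 g"
          using x \<open>x = 0\<close> by (auto simp: plug_def nth_Cons')
        ultimately show ?thesis using x f(1) mn by auto
      qed
      show "\<exists>g. length g = Suc N \<and> rigid d (d + m) g \<and>
        (\<forall>f f'. length f = m \<longrightarrow> length f' = m \<longrightarrow> rigid d (d + n) f \<longrightarrow> rigid d (d + n) f' \<longrightarrow>
          \<chi> (plug d f g) = \<chi> (plug d f' g))"
      proof (intro exI[of _ "0 # g"] conjI allI impI)
        show "rigid d (d + m) (0 # g)" using g(2) mn \<open>d = 0\<close> rigid_Cons_zero by simp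
        fix f f' assume f: "length f = m" "length f' = m" "rigid d (d + n) f" "rigid d (d + n) f'"
        obtain f1 where f1: "length f1 = m'" "rigid 1 (1 + n') f1" "plug d f (0 # g) = 0 # plug 1 f1 g"
          using split[of f] f \<open>d = 0\<close> by auto
        obtain f1' where f1': "length f1' = m'" "rigid 1 (1 + n') f1'" "plug d f' (0 # g) = 0 # plug 1 f1' g"
          using split[of f'] f \<open>d = 0\<close> by auto
        show "\<chi> (plug d f (0 # g)) = \<chi> (plug d f' (0 # g))"
          using g(3)[OF f1(1) f1'(1) f1(2) f1'(2)] f1(3) f1'(3) by simp
      qed (use g(1) in simp)
    qed
  qed
qed

section \<open>The dual Ramsey theorem for typed words\<close>

text \<open>
  The words that describe embeddings: \<open>U\<close> and \<open>T\<close> list the types of the atoms of the two algebras,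
  and \<open>w\<close> tells for each atom of the larger one under which atom of the smaller one it lies.
\<close>

definition typed_rigid :: "'t list \<Rightarrow> 't list \<Rightarrow> nat list \<Rightarrow> bool" where
  "typed_rigid U T w \<longleftrightarrow> length w = length U \<and> set w \<subseteq> {..<length T} \<and>
     (\<forall>i<length T. \<exists>b<length U. w ! b = i \<and> U ! b = T ! i \<and> (\<forall>c<b. w ! c < i))"

lemma typed_rigid_append:
  assumes "typed_rigid U T g" "rigid (length T) (length T + k) g'"
  shows "typed_rigid (U @ replicate (length g') t) (T @ replicate k t) (g @ g')"
  unfolding typed_rigid_def
proof (intro conjI allI impI)
  have g: "length g = length U" "set g \<subseteq> {..<length T}"
    "\<And>i. i < length T \<Longrightarrow> \<exists>b<length U. g ! b = i \<and> U ! b = T ! i \<and> (\<forall>c<b. g ! c < i)"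
    using assms(1) unfolding typed_rigid_def by auto
  show "length (g @ g') = length (U @ replicate (length g') t)" using g by simp
  show "set (g @ g') \<subseteq> {..<length (T @ replicate k t)}"
    using g(2) assms(2) by (auto simp: rigid_def)
  fix i assume i: "i < length (T @ replicate k t)"
  show "\<exists>b<length (U @ replicate (length g') t). (g @ g') ! b = i \<and>
      (U @ replicate (length g') t) ! b = (T @ replicate k t) ! i \<and> (\<forall>c<b. (g @ g') ! c < i)"
  proof (cases "i < length T")
    case True
    then obtain b where "b < length U" "g ! b = i" "U ! b = T ! i" "\<forall>c<b. g ! c < i"
      using g(3) by blast
    then show ?thesis using True g(1) by (intro exI[of _ b]) (simp add: nth_append)
  next
    case False
    then have "i \<in> {length T..<length T + k}" using i by simp
    then obtain b where b: "b < length g'" "g' ! b = i" "\<forall>c<b. g' ! c < i"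
      using assms(2) unfolding rigid_def by blast
    have "(g @ g') ! c < i" if "c < length U + b" for c
    proof (cases "c < length U")
      case True
      then have "g ! c < length T" using g(1,2) nth_mem by (metis lessThan_iff subset_iff)
      then show ?thesis using True False g(1) by (simp add: nth_append)
    next
      case c: False
      then have "c - length U < b" using that by simp
      then show ?thesis using c b(3) g(1) by (simp add: nth_append)
    qed
    then show ?thesis
      using b False i g(1) by (intro exI[of _ "length U + b"]) (simp add: nth_append)
  qed
qed

text \<open>
  If the last block of types is new, then the letters of type \<open>t\<close> can only be introduced in the last
  block, and all others must have been introduced before. This makes the last block a parameter word.
\<close>

lemma typed_rigid_split:
  assumes f: "typed_rigid (T @ replicate k t) (S @ replicate l t) f" and t: "t \<notin> set T" "t \<notin> set S"
  shows "typed_rigid T S (take (length T) f)" "rigid (length S) (length S + l) (drop (length T) f)"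
proof -
  have len: "length f = length T + k" and set_f: "set f \<subseteq> {..<length S + l}"
    using f unfolding typed_rigid_def by auto
  have first: "\<exists>b<length f. f ! b = i \<and> (T @ replicate k t) ! b = (S @ replicate l t) ! i \<and> (\<forall>c<b. f ! c < i)"
    if "i < length S + l" for i
    using f that unfolding typed_rigid_def by simp
  have old: "\<exists>b<length T. f ! b = i \<and> T ! b = S ! i \<and> (\<forall>c<b. f ! c < i)" if i: "i < length S" for i
  proof -
    obtain b where b: "b < length f" "f ! b = i"
      "(T @ replicate k t) ! b = (S @ replicate l t) ! i" "\<forall>c<b. f ! c < i"
      using first[of i] i by auto
    have "S ! i \<noteq> t" using t(2) i nth_mem by metis
    then have "b < length T" using b(1,3) i len by (auto simp: nth_append split: if_splits)
    then show ?thesis using b i by (auto simp: nth_append)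
  qed
  have new: "\<exists>b<length f. length T \<le> b \<and> f ! b = i \<and> (\<forall>c<b. f ! c < i)"
    if i: "length S \<le> i" "i < length S + l" for i
  proof -
    obtain b where b: "b < length f" "f ! b = i"
      "(T @ replicate k t) ! b = (S @ replicate l t) ! i" "\<forall>c<b. f ! c < i"
      using first[OF i(2)] by auto
    then have "(T @ replicate k t) ! b = t" using i by (simp add: nth_append)
    then have "length T \<le> b" using t(1) nth_mem[of b T] by (auto simp: nth_append split: if_splits)
    then show ?thesis using b by blast
  qed
  have small: "f ! c < length S" if c: "c < length T" for c
  proof (rule ccontr)
    assume "\<not> f ! c < length S"
    moreover have "f ! c < length S + l" using subsetD[OF set_f, OF nth_mem[of c f]] c len by simp
    ultimately obtain b where "length T \<le> b" "\<forall>c'<b. f ! c' < f ! c" using new[of "f ! c"] by auto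
    then show False using c by (meson less_irrefl less_le_trans)
  qed
  show "typed_rigid T S (take (length T) f)"
    unfolding typed_rigid_def
  proof (intro conjI allI impI)
    show "set (take (length T) f) \<subseteq> {..<length S}"
      using small len by (auto simp: in_set_conv_nth)
    fix i assume "i < length S"
    then obtain b where "b < length T" "f ! b = i" "T ! b = S ! i" "\<forall>c<b. f ! c < i"
      using old by blast
    then show "\<exists>b<length T. take (length T) f ! b = i \<and> T ! b = S ! i \<and> (\<forall>c<b. take (length T) f ! c < i)"
      by (intro exI[of _ b]) simp
  qed (use len in simp)
  have "\<exists>b<length (drop (length T) f). drop (length T) f ! b = i \<and> (\<forall>c<b. drop (length T) f ! c < i)"
    if i: "i \<in> {length S..<length S + l}" for i
  proof -
    have "length S \<le> i" "i < length S + l" using i by auto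
    then obtain b where b: "b < length f" "length T \<le> b" "f ! b = i" "\<forall>c<b. f ! c < i"
      using new by blast
    show ?thesis using b len by (intro exI[of _ "b - length T"]) auto
  qed
  moreover have "set (drop (length T) f) \<subseteq> {..<length S + l}"
    using set_f set_drop_subset[of "length T" f] by blast
  ultimately show "rigid (length S) (length S + l) (drop (length T) f)"
    unfolding rigid_def by simp
qed

lemma rigid_relabel:
  assumes h: "rigid d (d + k) h"
    and small: "\<And>x. x < d \<Longrightarrow> \<phi> x < a" and large: "\<And>j. \<phi> (d + j) = a + j"
  shows "rigid a (a + k) (map \<phi> h)"
proof -
  have lt: "\<phi> x < a + j" if "x < d + j" for x j
  proof (cases "x < d")
    case True
    then show ?thesis using small[of x] by simp
  next
    case False
    then show ?thesis using large[of "x - d"] that by simp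
  qed
  have "\<exists>b<length (map \<phi> h). map \<phi> h ! b = i \<and> (\<forall>c<b. map \<phi> h ! c < i)"
    if i: "i \<in> {a..<a + k}" for i
  proof -
    have "d + (i - a) \<in> {d..<d + k}" using i by auto
    then obtain b where b: "b < length h" "h ! b = d + (i - a)" "\<forall>c<b. h ! c < d + (i - a)"
      using h unfolding rigid_def by blast
    have "\<phi> (h ! c) < i" if "c < b" for c using lt[of "h ! c" "i - a"] b(3) that i by simp
    then show ?thesis using b(1,2) i large[of "i - a"] by (intro exI[of _ b]) simp
  qed
  moreover have "set (map \<phi> h) \<subseteq> {..<a + k}" using h lt unfolding rigid_def by auto
  ultimately show ?thesis unfolding rigid_def by simp
qed

definition blocks :: "'t list \<Rightarrow> ('t \<Rightarrow> nat) \<Rightarrow> 't list" where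
  "blocks ts n = concat (map (\<lambda>t. replicate (n t) t) ts)"

lemma blocks_snoc: "blocks (ts @ [t]) n = blocks ts n @ replicate (n t) t"
  by (simp add: blocks_def)

lemma set_blocks: "set (blocks ts n) \<subseteq> set ts"
  by (auto simp: blocks_def)

lemma blocks_fun_upd: "t \<notin> set ts \<Longrightarrow> blocks ts (n(t := k)) = blocks ts n"
  unfolding blocks_def by (intro arg_cong[where f = concat] map_cong) auto

text \<open>
  Induction on the list of types. For a new type \<open>t\<close> the Graham-Rothschild theorem is applied
  over the alphabet \<open>{..<d}\<close> of the places of \<open>U\<close>, the list obtained for the earlier types: a word
  over these places is turned into a word over letters of \<open>S\<close> by every typed word from \<open>U\<close> to \<open>S\<close>. One
  parameter word \<open>h\<close> serves all of these simultaneously, and what remains is a colouring of typed words from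
  \<open>U\<close> to \<open>S\<close>, to which the induction hypothesis applies.
\<close>

theorem block_ramsey:
  assumes "distinct ts"
  shows "\<exists>N. \<forall>\<chi> :: nat list \<Rightarrow> nat. (\<forall>w. \<chi> w < r) \<longrightarrow>
    (\<exists>g. typed_rigid (blocks ts N) (blocks ts m) g \<and>
      (\<forall>f f'. typed_rigid (blocks ts m) (blocks ts n) f \<longrightarrow> typed_rigid (blocks ts m) (blocks ts n) f' \<longrightarrow>
        \<chi> (map ((!) f) g) = \<chi> (map ((!) f') g)))"
  using assms
proof (induction ts rule: rev_induct)
  case Nil
  show ?case by (intro exI allI impI exI[of _ "[]"]) (simp add: typed_rigid_def blocks_def)
next
  case (snoc t ts)
  have t: "t \<notin> set ts" using snoc.prems by simp
  let ?T = "blocks ts m" and ?S = "blocks ts n"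
  have tTS: "t \<notin> set ?T" "t \<notin> set ?S" using t set_blocks by fastforce+
  obtain N' where N': "\<And>\<chi> :: nat list \<Rightarrow> nat. (\<forall>w. \<chi> w < r) \<Longrightarrow>
    (\<exists>g. typed_rigid (blocks ts N') ?T g \<and> (\<forall>f f'. typed_rigid ?T ?S f \<longrightarrow> typed_rigid ?T ?S f' \<longrightarrow>
        \<chi> (map ((!) f) g) = \<chi> (map ((!) f') g)))"
    using snoc by auto
  let ?U = "blocks ts N'"
  define d a b where "d = length ?U" and "a = length ?T" and "b = length ?S"
  define I where "I = {w :: nat list. length w = d \<and> set w \<subseteq> {..<b}}"
  have "finite I" unfolding I_def by (rule finite_words)
  then obtain R :: nat where R: "\<And>F :: nat list \<Rightarrow> nat list \<Rightarrow> nat.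
    (\<And>v w. w \<in> I \<Longrightarrow> F v w < r) \<Longrightarrow>
    \<exists>c. (\<forall>v. c v < R) \<and> (\<forall>v v'. c v = c v' \<longrightarrow> (\<forall>w\<in>I. F v w = F v' w))"
    by (rule finite_family_coding[of I r, where ?'a = "nat list"]) blast+
  obtain N where N: "\<And>\<chi> :: nat list \<Rightarrow> nat. (\<forall>w. \<chi> w < R) \<Longrightarrow>
    (\<exists>g. length g = N \<and> rigid d (d + m t) g \<and>
      (\<forall>f f'. length f = m t \<longrightarrow> length f' = m t \<longrightarrow> rigid d (d + n t) f \<longrightarrow> rigid d (d + n t) f' \<longrightarrow>
        \<chi> (plug d f g) = \<chi> (plug d f' g)))"
    using graham_rothschild[of R d "m t" "n t"] by blast
  define Nt where "Nt = N'(t := N)"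
  have U: "blocks (ts @ [t]) Nt = ?U @ replicate N t"
    unfolding blocks_snoc Nt_def blocks_fun_upd[OF t] by simp
  have T: "blocks (ts @ [t]) m = ?T @ replicate (m t) t"
    and S: "blocks (ts @ [t]) n = ?S @ replicate (n t) t" by (simp_all add: blocks_snoc)
  show ?case
  proof (intro exI[of _ Nt] allI impI)
    fix \<chi> :: "nat list \<Rightarrow> nat"
    assume chi: "\<forall>w. \<chi> w < r"
    \<comment> \<open>Reads a constant \<open>x\<close> of the new block as the letter that \<open>w\<close> has at the place \<open>x\<close>, and renumbers the parameters.\<close>
    define ext where "ext w x = (if x < d then w ! x else x - d + b)" for w :: "nat list" and x
    obtain c where c: "\<forall>v. c v < R"
      "\<forall>v v'. c v = c v' \<longrightarrow> (\<forall>w\<in>I. \<chi> (w @ map (ext w) v) = \<chi> (w @ map (ext w) v'))"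
      using R[of "\<lambda>v w. \<chi> (w @ map (ext w) v)", OF spec[OF chi]] by blast
    obtain h where h: "length h = N" "rigid d (d + m t) h"
      "\<And>f f'. length f = m t \<Longrightarrow> length f' = m t \<Longrightarrow> rigid d (d + n t) f \<Longrightarrow> rigid d (d + n t) f' \<Longrightarrow>
        c (plug d f h) = c (plug d f' h)"
      using N[OF c(1)] by blast
    define Q where "Q f \<longleftrightarrow> length f = m t \<and> rigid d (d + n t) f" for f
    define \<chi>' where "\<chi>' w = \<chi> (w @ map (ext w) (plug d (SOME f. Q f) h))" for w
    have "\<forall>w. \<chi>' w < r" unfolding \<chi>'_def using chi by blast
    then obtain g0 where g0: "typed_rigid ?U ?T g0"
      "\<And>f f'. typed_rigid ?T ?S f \<Longrightarrow> typed_rigid ?T ?S f' \<Longrightarrow> \<chi>' (map ((!) f) g0) = \<chi>' (map ((!) f') g0)"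
      using N' by blast
    have g0_len: "length g0 = d" and g0_lt: "\<And>x. x < d \<Longrightarrow> g0 ! x < a"
      using g0(1) nth_mem unfolding typed_rigid_def d_def a_def by (auto simp: subset_iff)
    \<comment> \<open>The constants of \<open>h\<close> are identified as \<open>g0\<close> prescribes.\<close>
    define \<gamma> where "\<gamma> x = (if x < d then g0 ! x else x - d + a)" for x
    define g where "g = g0 @ map \<gamma> h"
    have "rigid a (a + m t) (map \<gamma> h)"
      using h(2) by (rule rigid_relabel) (use g0_lt in \<open>auto simp: \<gamma>_def\<close>)
    then have typed_rigid_g: "typed_rigid (?U @ replicate N t) (?T @ replicate (m t) t) g"
      using typed_rigid_append[OF g0(1), of "m t" "map \<gamma> h" t] h(1) unfolding g_def a_def by simp
    have reduce: "\<exists>f0. typed_rigid ?T ?S f0 \<and> \<chi> (map ((!) f) g) = \<chi>' (map ((!) f0) g0)"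
      if f: "typed_rigid (?T @ replicate (m t) t) (?S @ replicate (n t) t) f" for f
    proof -
      define f0 f1 where "f0 = take a f" and "f1 = drop a f"
      have f0: "typed_rigid ?T ?S f0" and f1: "rigid b (b + n t) f1"
        using typed_rigid_split[OF f tTS] unfolding f0_def f1_def a_def b_def by auto
      have len_f: "length f = a + m t" using f unfolding typed_rigid_def a_def by simp
      have f0_lt: "f0 ! x < b" if "x < a" for x
        using f0 that nth_mem unfolding typed_rigid_def a_def b_def by (auto simp: subset_iff)
      define e0 where "e0 = map ((!) f0) g0"
      have e0: "e0 \<in> I" unfolding I_def e0_def using g0_len g0_lt f0_lt
        by (auto simp: in_set_conv_nth)
      have onto: "\<exists>x<d. e0 ! x = y" if y: "y < b" for y
      proof -
        obtain p where p: "p < a" "f0 ! p = y" using f0 y unfolding typed_rigid_def a_def b_def by blast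
        then obtain x where "x < d" "g0 ! x = p" using g0(1) unfolding typed_rigid_def a_def d_def by blast
        then show ?thesis using p g0_len unfolding e0_def by auto
      qed
      \<comment> \<open>The second part of \<open>f\<close> may use letters of \<open>S\<close> as constants, which are lifted to places of \<open>U\<close>
        carrying them in the composite of \<open>f0\<close> and \<open>g0\<close>; any choice of places gives the same word in the end.\<close>
      define \<phi> where "\<phi> y = (if y < b then SOME x. x < d \<and> e0 ! x = y else y - b + d)" for y
      have phi: "\<phi> y < d" "e0 ! \<phi> y = y" if "y < b" for y
        using someI_ex[OF onto[OF that]] that unfolding \<phi>_def by auto
      have ext_phi: "ext e0 (\<phi> y) = y" for y
        using phi[of y] by (cases "y < b") (auto simp: ext_def \<phi>_def)
      define f1' where "f1' = map \<phi> f1"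
      have "rigid d (d + n t) f1'"
        unfolding f1'_def using f1 by (rule rigid_relabel) (use phi in \<open>auto simp: \<phi>_def\<close>)
      then have Q1: "Q f1'" unfolding Q_def f1'_def f1_def using len_f by simp
      then have "Q (SOME f. Q f)" by (rule someI)
      then have same: "\<chi>' e0 = \<chi> (e0 @ map (ext e0) (plug d f1' h))"
        unfolding \<chi>'_def using c(2) h(3) Q1 e0 unfolding Q_def by blast
      have "f ! \<gamma> x = ext e0 (if x < d then x else f1' ! (x - d))" if "x \<in> set h" for x
      proof (cases "x < d")
        case True
        then show ?thesis using g0_lt[OF True] g0_len
          by (simp add: \<gamma>_def ext_def e0_def f0_def)
      next
        case False
        then have p: "x - d < m t" using that h(2) unfolding rigid_def by auto
        then have "f1' ! (x - d) = \<phi> (f ! (a + (x - d)))"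
          unfolding f1'_def f1_def using len_f by simp
        then show ?thesis using False ext_phi by (simp add: \<gamma>_def add.commute)
      qed
      then have "map ((!) f) (map \<gamma> h) = map (ext e0) (plug d f1' h)"
        unfolding plug_def by simp
      moreover have "map ((!) f) g0 = e0"
        unfolding e0_def f0_def using g0_lt g0_len by (auto simp: in_set_conv_nth)
      ultimately have "map ((!) f) g = e0 @ map (ext e0) (plug d f1' h)"
        unfolding g_def by simp
      then show ?thesis using same f0 unfolding e0_def by auto
    qed
    show "\<exists>g. typed_rigid (blocks (ts @ [t]) Nt) (blocks (ts @ [t]) m) g \<and>
      (\<forall>f f'. typed_rigid (blocks (ts @ [t]) m) (blocks (ts @ [t]) n) f \<longrightarrow>
        typed_rigid (blocks (ts @ [t]) m) (blocks (ts @ [t]) n) f' \<longrightarrow>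
        \<chi> (map ((!) f) g) = \<chi> (map ((!) f') g))"
      unfolding U T S using typed_rigid_g reduce g0(2) by (metis (no_types, lifting))
  qed
qed

lemma sorted_blocks:
  fixes ts :: "'t::order list"
  assumes "sorted_wrt (<) ts"
  shows "sorted_wrt (\<le>) (blocks ts n)"
  using assms
proof (induction ts)
  case (Cons t ts)
  have "sorted_wrt (\<le>) (replicate k t)" for k
    by (induction k) auto
  moreover have "blocks (t # ts) n = replicate (n t) t @ blocks ts n" by (simp add: blocks_def)
  ultimately show ?case
    using Cons set_blocks[of ts n] by (auto simp: sorted_wrt_append less_imp_le subset_iff)
qed (simp add: blocks_def)

lemma sorted_imp_blocks:
  fixes ts T :: "'t::order list"
  assumes "sorted_wrt (<) ts" "sorted_wrt (\<le>) T" "set T \<subseteq> set ts"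
  shows "\<exists>n. T = blocks ts n"
  using assms
proof (induction ts arbitrary: T)
  case Nil
  then show ?case by (simp add: blocks_def)
next
  case (Cons t ts)
  let ?T = "dropWhile ((=) t) T"
  have T: "T = takeWhile ((=) t) T @ ?T" by simp
  have "sorted_wrt (\<le>) (takeWhile ((=) t) T @ ?T)" using Cons.prems(2) by simp
  then have sorted: "sorted_wrt (\<le>) ?T" unfolding sorted_wrt_append by blast
  have "t \<notin> set ?T"
  proof (cases ?T)
    case (Cons y ys)
    then have y: "y \<noteq> t" "y \<in> set T"
      using hd_dropWhile[of "(=) t" T] set_dropWhileD[of y "(=) t" T] by auto
    then have "t < y" using Cons.prems(1,3) \<open>sorted_wrt (<) (t # ts)\<close> \<open>set T \<subseteq> set (t # ts)\<close> by auto
    then show ?thesis using sorted Cons by auto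
  next
    case Nil
    show ?thesis unfolding Nil by simp
  qed
  then have "set ?T \<subseteq> set ts" using Cons.prems(3) set_dropWhileD[of _ "(=) t" T] by fastforce
  moreover have "sorted_wrt (<) ts" using Cons.prems(1) by simp
  ultimately obtain n where n: "?T = blocks ts n" using Cons.IH[OF _ sorted] by blast
  have "takeWhile ((=) t) T = replicate (length (takeWhile ((=) t) T)) t"
    by (rule replicate_eqI) (auto dest: set_takeWhileD)
  moreover have "blocks (t # ts) (n(t := k)) = replicate k t @ blocks ts n" for k
    using blocks_fun_upd[of t ts n k] Cons.prems(1) by (auto simp: blocks_def)
  ultimately show ?case using T n by metis
qed

lemma sorted_wrt_imp_distinct:
  fixes ts :: "'t::order list"
  shows "sorted_wrt (<) ts \<Longrightarrow> distinct ts"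
  by (induction ts) auto

lemma finite_chain_imp_sorted_list:
  fixes X :: "'t::order set"
  assumes "finite X" "\<And>x y. x \<in> X \<Longrightarrow> y \<in> X \<Longrightarrow> x \<le> y \<or> y \<le> x"
  shows "\<exists>ts. sorted_wrt (<) ts \<and> set ts = X"
  using assms
proof (induction "card X" arbitrary: X)
  case 0
  then show ?case by (intro exI[of _ "[]"]) simp
next
  case (Suc k)
  then have "X \<noteq> {}" by auto
  then obtain z where z: "z \<in> X" "\<forall>x\<in>X. z \<le> x \<longrightarrow> z = x"
    using finite_has_maximal[OF Suc.prems(1)] by blast
  have "card (X - {z}) = k" using Suc z by simp
  then obtain ts where ts: "sorted_wrt (<) ts" "set ts = X - {z}"
    using Suc.hyps(1)[of "X - {z}"] Suc.prems by auto
  have "sorted_wrt (<) (ts @ [z])"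
    using ts z Suc.prems(2) by (auto simp: sorted_wrt_append order.strict_iff_order)
  then show ?case using ts z by (intro exI[of _ "ts @ [z]"]) auto
qed

text \<open>
  Increasing lists with comparable entries are lists of blocks for one common sequence of types, with
  empty blocks for those types that do not occur.
\<close>

theorem typed_dual_ramsey:
  fixes S T :: "'t::order list"
  assumes "sorted_wrt (\<le>) S" "sorted_wrt (\<le>) T"
    and chain: "\<And>x y. x \<in> set S \<union> set T \<Longrightarrow> y \<in> set S \<union> set T \<Longrightarrow> x \<le> y \<or> y \<le> x"
  obtains U where "sorted_wrt (\<le>) U" "set U \<subseteq> set S \<union> set T"
    "\<And>\<chi> :: nat list \<Rightarrow> nat. (\<And>w. \<chi> w < r) \<Longrightarrow>
      \<exists>g. typed_rigid U T g \<and>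
        (\<forall>f f'. typed_rigid T S f \<longrightarrow> typed_rigid T S f' \<longrightarrow> \<chi> (map ((!) f) g) = \<chi> (map ((!) f') g))"
proof -
  obtain ts where ts: "sorted_wrt (<) ts" "set ts = set S \<union> set T"
    using finite_chain_imp_sorted_list[of "set S \<union> set T"] chain by auto
  have "distinct ts" using ts(1) by (rule sorted_wrt_imp_distinct)
  obtain n where n: "S = blocks ts n" using sorted_imp_blocks[OF ts(1) assms(1)] ts(2) by auto
  obtain m where m: "T = blocks ts m" using sorted_imp_blocks[OF ts(1) assms(2)] ts(2) by auto
  obtain N where N: "\<forall>\<chi> :: nat list \<Rightarrow> nat. (\<forall>w. \<chi> w < r) \<longrightarrow>
    (\<exists>g. typed_rigid (blocks ts N) T g \<and>
      (\<forall>f f'. typed_rigid T S f \<longrightarrow> typed_rigid T S f' \<longrightarrow> \<chi> (map ((!) f) g) = \<chi> (map ((!) f') g)))"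
    using block_ramsey[OF \<open>distinct ts\<close>, of r m n] unfolding n m by blast
  show thesis
    using that[of "blocks ts N"] sorted_blocks[OF ts(1)] set_blocks[of ts N] N ts(2) by blast
qed

section \<open>Embeddings and copies\<close>

lemma embedding_comp:
  assumes "embedding J A B h" "embedding J B C g"
  shows "embedding J A C (g \<circ> h)"
proof -
  have mem: "h x \<in> carrier B" if "x \<in> carrier A" for x
    using assms(1) that by (auto simp: embedding_def)
  have "inj_on (g \<circ> h) (carrier A)"
    using assms mem unfolding embedding_def by (auto intro!: comp_inj_on intro: inj_on_subset)
  then show ?thesis
    using assms mem unfolding embedding_def by (auto simp: image_subset_iff)
qed

text \<open>
  An embedding factors through another one as soon as its image is contained in the image of the
  other. It serves to invert isomorphisms and to turn copies inside a copy into embeddings.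
\<close>

lemma embedding_lift:
  assumes A: "bool_alg A" and B: "bool_alg B"
    and e: "embedding J A C e" and g: "embedding J B C g"
    and im: "e ` carrier A \<subseteq> g ` carrier B"
  shows "\<exists>k. embedding J A B k \<and> (\<forall>x\<in>carrier A. g (k x) = e x)"
proof -
  interpret A: bool_alg A by (rule A)
  interpret B: bool_alg B by (rule B)
  define k where "k = inv_into (carrier B) g \<circ> e"
  have kB: "k x \<in> carrier B" and gk: "g (k x) = e x" if "x \<in> carrier A" for x
    using im that unfolding k_def by (auto intro!: inv_into_into f_inv_into_f)
  have inj: "inj_on g (carrier B)" using g by (simp add: embedding_def)
  have uniq: "k x = y" if "x \<in> carrier A" "y \<in> carrier B" "e x = g y" for x y
    using inj kB[OF that(1)] gk[OF that(1)] that(2,3) by (auto dest: inj_onD)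
  have "embedding J A B k"
    unfolding embedding_def
  proof (intro conjI ballI)
    show "k ` carrier A \<subseteq> carrier B" using kB by blast
    show "inj_on k (carrier A)"
      using gk e unfolding embedding_def inj_on_def by metis
    fix x y assume x: "x \<in> carrier A" and y: "y \<in> carrier A"
    show "k (x \<squnion>\<^bsub>A\<^esub> y) = k x \<squnion>\<^bsub>B\<^esub> k y" "k (x \<sqinter>\<^bsub>A\<^esub> y) = k x \<sqinter>\<^bsub>B\<^esub> k y"
      using x y e g kB gk unfolding embedding_def
      by (auto intro!: uniq A.join_closed A.meet_closed B.join_closed B.meet_closed)
    show "((x, y) \<in> ord A) = ((k x, k y) \<in> ord B)"
      using x y e g kB gk unfolding embedding_def by metis
  next
    show "k \<zero>\<^bsub>A\<^esub> = \<zero>\<^bsub>B\<^esub>" "k \<one>\<^bsub>A\<^esub> = \<one>\<^bsub>B\<^esub>"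
      using e g unfolding embedding_def
      by (auto intro!: uniq A.zero_closed A.one_closed B.zero_closed B.one_closed)
  next
    fix x assume x: "x \<in> carrier A"
    show "k (\<sim>\<^bsub>A\<^esub> x) = \<sim>\<^bsub>B\<^esub> k x"
      using x e g kB gk unfolding embedding_def by (auto intro!: uniq A.neg_closed B.neg_closed)
  next
    fix j x assume "j \<in> J" "x \<in> carrier A"
    then show "(x \<in> pred A j) = (k x \<in> pred B j)"
      using e g kB gk unfolding embedding_def by metis
  qed
  then show ?thesis using gk by blast
qed

lemma embedding_substructure_iff:
  assumes "S \<subseteq> carrier C"
  shows "embedding J A (substructure C S) h \<longleftrightarrow> embedding J A C h \<and> h ` carrier A \<subseteq> S"
  using assms unfolding embedding_def substructure_def by (auto simp: image_subset_iff)

lemma substructure_substructure: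
  "S' \<subseteq> S \<Longrightarrow> substructure (substructure C S) S' = substructure C S'"
  unfolding substructure_def by (auto intro!: ord_pred_alg.equality ext)

lemma subuniverse_image:
  assumes "bool_alg A" "embedding J A C h"
  shows "subuniverse C (h ` carrier A)"
proof -
  interpret bool_alg A by fact
  show ?thesis
    using assms(2) unfolding subuniverse_def embedding_def
    by (auto simp: image_iff
        intro: zero_closed one_closed neg_closed join_closed meet_closed
        dest: sym) (metis zero_closed one_closed neg_closed join_closed meet_closed)+
qed

lemma copies_eq_images:
  assumes "bool_alg A"
  shows "copies J A C = {substructure C (h ` carrier A) | h. embedding J A C h}"
proof (intro equalityI subsetI)
  fix X assume "X \<in> copies J A C"
  then obtain S h where S: "X = substructure C S" "subuniverse C S"
    and h: "embedding J A (substructure C S) h" "h ` carrier A = carrier (substructure C S)"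
    unfolding copies_def isomorphic_def by blast
  have "S \<subseteq> carrier C" using S(2) by (simp add: subuniverse_def)
  then have "embedding J A C h" using embedding_substructure_iff h(1) by blast
  moreover have "h ` carrier A = S" using h(2) by (simp add: substructure_def)
  ultimately show "X \<in> {substructure C (h ` carrier A) | h. embedding J A C h}" using S(1) by blast
next
  fix X assume "X \<in> {substructure C (h ` carrier A) | h. embedding J A C h}"
  then obtain h where h: "X = substructure C (h ` carrier A)" "embedding J A C h" by blast
  have sub: "subuniverse C (h ` carrier A)" using subuniverse_image[OF assms h(2)] .
  then have "embedding J A (substructure C (h ` carrier A)) h"
    using h(2) embedding_substructure_iff[of "h ` carrier A" C J A h] by (simp add: subuniverse_def)
  then have "isomorphic J A (substructure C (h ` carrier A))"
    unfolding isomorphic_def by (intro exI[of _ h]) (simp add: substructure_def)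
  then show "X \<in> copies J A C" using sub h(1) unfolding copies_def by blast
qed

section \<open>Algebras of sets of typed atoms\<close>

text \<open>
  The antilexicographic order when atoms are numbered from the largest downwards: the largest atom on
  which two elements differ is the one with the least number.
\<close>

definition first_diff :: "nat set \<Rightarrow> nat set \<Rightarrow> bool" where
  "first_diff X Y \<longleftrightarrow> (\<exists>i\<in>Y - X. \<forall>k<i. k \<in> X \<longleftrightarrow> k \<in> Y)"

lemma first_diff_irrefl: "\<not> first_diff X X"
  by (simp add: first_diff_def)

lemma first_diff_trans:
  assumes "first_diff X Y" "first_diff Y Z"
  shows "first_diff X Z"
proof -
  obtain i where i: "i \<in> Y - X" "\<forall>k<i. k \<in> X \<longleftrightarrow> k \<in> Y" using assms(1) unfolding first_diff_def by blast
  obtain j where j: "j \<in> Z - Y" "\<forall>k<j. k \<in> Y \<longleftrightarrow> k \<in> Z" using assms(2) unfolding first_diff_def by blast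
  consider "i < j" | "j < i" using i j by (metis DiffD1 DiffD2 linorder_neqE_nat)
  then show ?thesis
  proof cases
    case 1
    then show ?thesis unfolding first_diff_def using i j by (intro bexI[of _ i]) auto
  next
    case 2
    then show ?thesis unfolding first_diff_def using i j by (intro bexI[of _ j]) auto
  qed
qed

lemma first_diff_total:
  assumes "X \<noteq> Y"
  shows "first_diff X Y \<or> first_diff Y X"
proof -
  define i where "i = (LEAST i. (i \<in> X) \<noteq> (i \<in> Y))"
  have "\<exists>i. (i \<in> X) \<noteq> (i \<in> Y)" using assms by blast
  then have "(i \<in> X) \<noteq> (i \<in> Y)" unfolding i_def by (rule LeastI_ex)
  moreover have "\<forall>k<i. k \<in> X \<longleftrightarrow> k \<in> Y" unfolding i_def using not_less_Least by blast
  ultimately show ?thesis unfolding first_diff_def by blast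
qed

lemma first_diff_iff_greatest:
  assumes "X \<subseteq> {..<n}" "Y \<subseteq> {..<n}"
  shows "first_diff X Y \<longleftrightarrow> (\<exists>i<n. i \<in> Y \<and> i \<notin> X \<and>
      (\<forall>k<n. (k \<in> X) \<noteq> (k \<in> Y) \<longrightarrow> k = i \<or> i < k))"
proof
  assume "first_diff X Y"
  then obtain i where i: "i \<in> Y - X" and same: "\<forall>k<i. k \<in> X \<longleftrightarrow> k \<in> Y"
    unfolding first_diff_def by (elim bexE) (rule that)
  have "k = i \<or> i < k" if "(k \<in> X) \<noteq> (k \<in> Y)" for k
  proof (rule ccontr)
    assume "\<not> (k = i \<or> i < k)"
    then have "k < i" by simp
    then show False using same that by blast
  qed
  then show "\<exists>i<n. i \<in> Y \<and> i \<notin> X \<and> (\<forall>k<n. (k \<in> X) \<noteq> (k \<in> Y) \<longrightarrow> k = i \<or> i < k)"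
    using i assms(2) by (intro exI[of _ i]) auto
next
  assume "\<exists>i<n. i \<in> Y \<and> i \<notin> X \<and> (\<forall>k<n. (k \<in> X) \<noteq> (k \<in> Y) \<longrightarrow> k = i \<or> i < k)"
  then obtain i where i: "i < n" "i \<in> Y" "i \<notin> X"
    and later: "\<forall>k<n. (k \<in> X) \<noteq> (k \<in> Y) \<longrightarrow> k = i \<or> i < k"
    by (elim conjE exE) (rule that)
  have "k \<in> X \<longleftrightarrow> k \<in> Y" if "k < i" for k
  proof (rule ccontr)
    assume "(k \<in> X) \<noteq> (k \<in> Y)"
    moreover have "k < n" using i(1) that by simp
    ultimately have "k = i \<or> i < k" using later by blast
    then show False using that by simp
  qed
  then show "first_diff X Y" unfolding first_diff_def using i by blast
qed

text \<open>
  The power set algebra on the positions of \<open>T\<close>, where position \<open>i\<close> is an atom of type \<open>T ! i\<close> and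
  smaller positions are larger atoms. Finite sets of natural numbers are coded by natural numbers.
\<close>

definition type_alg :: "'j set list \<Rightarrow> (nat, 'j) ord_pred_alg" where
  "type_alg T = \<lparr>carrier = {x. set_decode x \<subseteq> {..<length T}},
     join = (\<lambda>x y. set_encode (set_decode x \<union> set_decode y)),
     meet = (\<lambda>x y. set_encode (set_decode x \<inter> set_decode y)),
     bzero = 0,
     bone = set_encode {..<length T},
     neg = (\<lambda>x. set_encode ({..<length T} - set_decode x)),
     pred = (\<lambda>j. {x. set_decode x \<subseteq> {..<length T} \<and> (\<forall>i\<in>set_decode x. j \<in> T ! i)}),
     ord = {(x, y). set_decode x \<subseteq> {..<length T} \<and> set_decode y \<subseteq> {..<length T} \<and>
       first_diff (set_decode x) (set_decode y)}\<rparr>"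

lemma type_alg_simps [simp]:
  "x \<in> carrier (type_alg T) \<longleftrightarrow> set_decode x \<subseteq> {..<length T}"
  "set_decode (x \<squnion>\<^bsub>type_alg T\<^esub> y) = set_decode x \<union> set_decode y"
  "set_decode (x \<sqinter>\<^bsub>type_alg T\<^esub> y) = set_decode x \<inter> set_decode y"
  "set_decode \<zero>\<^bsub>type_alg T\<^esub> = {}"
  "set_decode \<one>\<^bsub>type_alg T\<^esub> = {..<length T}"
  "set_decode (\<sim>\<^bsub>type_alg T\<^esub> x) = {..<length T} - set_decode x"
  "x \<in> pred (type_alg T) j \<longleftrightarrow> set_decode x \<subseteq> {..<length T} \<and> (\<forall>i\<in>set_decode x. j \<in> T ! i)"
  "(x, y) \<in> ord (type_alg T) \<longleftrightarrow> set_decode x \<subseteq> {..<length T} \<and> set_decode y \<subseteq> {..<length T} \<and>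
     first_diff (set_decode x) (set_decode y)"
  by (simp_all add: type_alg_def)

(* Codes of singletons are kept as they are and not evaluated to powers of two. *)
declare set_encode_insert [simp del]

lemma eq_iff_set_decode_eq: "x = y \<longleftrightarrow> set_decode x = set_decode y"
  by (metis set_decode_inverse)

lemma below_type_alg: "below (type_alg T) x y \<longleftrightarrow> set_decode x \<subseteq> set_decode y"
  unfolding below_def eq_iff_set_decode_eq by auto

lemma bool_alg_type_alg: "bool_alg (type_alg T)"
  by unfold_locales (auto simp: eq_iff_set_decode_eq)

lemma finite_carrier_type_alg: "finite (carrier (type_alg T))"
proof -
  have "carrier (type_alg T) \<subseteq> set_encode ` Pow {..<length T}"
  proof
    fix x assume "x \<in> carrier (type_alg T)"
    then show "x \<in> set_encode ` Pow {..<length T}"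
      by (intro image_eqI[of _ _ "set_decode x"]) auto
  qed
  then show ?thesis using finite_subset by blast
qed

lemma atoms_type_alg: "atoms (type_alg T) = (\<lambda>i. set_encode {i}) ` {..<length T}"
proof (intro equalityI subsetI)
  fix a assume a: "a \<in> atoms (type_alg T)"
  then have "set_decode a \<noteq> {}" "set_decode a \<subseteq> {..<length T}"
    unfolding atoms_def by (auto simp: eq_iff_set_decode_eq[of a])
  then obtain i where i: "i \<in> set_decode a" "i < length T" by blast
  then have "set_encode {i} = \<zero>\<^bsub>type_alg T\<^esub> \<or> set_encode {i} = a"
    using a unfolding atoms_def below_type_alg by auto
  then have "a = set_encode {i}" by (auto simp: eq_iff_set_decode_eq)
  then show "a \<in> (\<lambda>i. set_encode {i}) ` {..<length T}" using i by blast
next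
  fix a assume "a \<in> (\<lambda>i. set_encode {i}) ` {..<length T}"
  then obtain i where i: "a = set_encode {i}" "i < length T" by blast
  have "x = \<zero>\<^bsub>type_alg T\<^esub> \<or> x = a" if "set_decode x \<subseteq> {i}" for x
    using that i(1) unfolding subset_singleton_iff eq_iff_set_decode_eq[of x] by simp
  moreover have "a \<noteq> \<zero>\<^bsub>type_alg T\<^esub>" using i(1) unfolding eq_iff_set_decode_eq[of a] by simp
  ultimately show "a \<in> atoms (type_alg T)"
    unfolding atoms_def below_type_alg using i by simp
qed

text \<open>
  The lists that arise from algebras in the class: the ideals are increasing, so types are upward
  closed; some atom lies in no ideal, so the empty type occurs, and it comes first.
\<close>

definition type_list :: "'j::linorder set \<Rightarrow> 'j set list \<Rightarrow> bool" where
  "type_list J T \<longleftrightarrow> T \<noteq> [] \<and> T ! 0 = {} \<and> sorted_wrt (\<le>) T \<and>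
     (\<forall>t\<in>set T. t \<subseteq> J \<and> (\<forall>i\<in>t. \<forall>j\<in>J. i < j \<longrightarrow> j \<in> t))"

lemma type_alg_NA:
  assumes T: "type_list J T"
  shows "type_alg T \<in> NA J"
proof -
  let ?A = "type_alg T"
  have T0: "0 < length T" "T ! 0 = {}" using T by (auto simp: type_list_def)
  have up: "j \<in> T ! i" if "i < length T" "i' \<in> T ! i" "j \<in> J" "i' < j" for i i' j
    using T that nth_mem unfolding type_list_def by blast
  have mono: "T ! i \<subseteq> T ! k" if "i \<le> k" "k < length T" for i k
    using T that sorted_wrt_nth_less[of "(\<le>)" T i k] unfolding type_list_def by (cases "i = k") auto
  have ideal: "is_ideal ?A (pred ?A j)" for j
    using T0 unfolding is_ideal_def below_type_alg by auto
  have chain: "pred ?A i \<subseteq> pred ?A j" if "i \<in> J" "j \<in> J" "i < j" for i j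
    using up that by (auto simp: subset_iff)
  have "\<exists>a\<in>atoms ?A. \<forall>j\<in>J. a \<notin> pred ?A j"
    using T0 by (intro bexI[of _ "set_encode {0}"]) (auto simp: atoms_type_alg)
  then have alg: "?A \<in> ideal_chain_algs J"
    unfolding ideal_chain_algs_def using bool_alg_type_alg finite_carrier_type_alg ideal chain by blast
  define r where "r = {(set_encode {i}, set_encode {k}) | i k. k < i \<and> i < length T}"
  have mem_r: "(set_encode {i}, set_encode {k}) \<in> r \<longleftrightarrow> k < i \<and> i < length T" for i k
    unfolding r_def by (auto simp: set_encode_eq)
  have "trans r"
    unfolding r_def trans_def by (fastforce simp: set_encode_eq)
  moreover have "irrefl r"
    unfolding r_def irrefl_def by (auto simp: set_encode_eq)
  moreover have "total_on (atoms ?A) r"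
    unfolding total_on_def atoms_type_alg by (auto simp: mem_r set_encode_eq)
  moreover have "r \<subseteq> atoms ?A \<times> atoms ?A"
    unfolding r_def atoms_type_alg by auto
  moreover have "(a, b) \<in> r"
    if "a \<in> atoms ?A" "b \<in> atoms ?A" "i \<in> J" "a \<in> pred ?A i"
      "(\<exists>j\<in>J. i < j \<and> b \<in> pred ?A j - pred ?A i) \<or> (\<forall>k\<in>J. b \<notin> pred ?A k)" for a b i
  proof -
    obtain p where p: "a = set_encode {p}" "p < length T" using \<open>a \<in> atoms ?A\<close> atoms_type_alg by blast
    obtain q where q: "b = set_encode {q}" "q < length T" using \<open>b \<in> atoms ?A\<close> atoms_type_alg by blast
    have "i \<in> T ! p" "i \<notin> T ! q" using that(3-5) p q by auto
    then have "\<not> p \<le> q" using mono[of p q] q(2) by blast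
    then show ?thesis using p q mem_r by simp
  qed
  ultimately have proper: "proper_ordering J ?A r"
    unfolding proper_ordering_def strict_linear_order_on_def by blast
  have separates: "separates ?A (set_encode {i}) x y \<longleftrightarrow> (i \<in> set_decode x) \<noteq> (i \<in> set_decode y)" for i x y
    unfolding separates_def below_type_alg by simp
  have "(x, y) \<in> ord ?A \<longleftrightarrow> (x, y) \<in> antilex ?A r" for x y
  proof (cases "x \<in> carrier ?A \<and> y \<in> carrier ?A")
    case True
    then have x: "set_decode x \<subseteq> {..<length T}" and y: "set_decode y \<subseteq> {..<length T}" by auto
    have "(x, y) \<in> antilex ?A r \<longleftrightarrow> x \<noteq> y \<and> (\<exists>i<length T. i \<in> set_decode y \<and> i \<notin> set_decode x \<and>
        (\<forall>k<length T. (k \<in> set_decode x) \<noteq> (k \<in> set_decode y) \<longrightarrow> k = i \<or> i < k))"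
      using True unfolding antilex_def atoms_type_alg
      by (auto simp: separates mem_r below_type_alg set_encode_eq)
    also have "\<dots> \<longleftrightarrow> first_diff (set_decode x) (set_decode y)"
      unfolding first_diff_iff_greatest[OF x y, symmetric] using first_diff_irrefl by auto
    finally show ?thesis using x y by simp
  qed (auto simp: antilex_def)
  then have ord: "ord ?A = antilex ?A r" by auto
  have "trans (ord ?A)" unfolding trans_def using first_diff_trans by auto
  moreover have "irrefl (ord ?A)" unfolding irrefl_def using first_diff_irrefl by auto
  moreover have "total_on (carrier ?A) (ord ?A)"
    unfolding total_on_def using first_diff_total eq_iff_set_decode_eq by auto
  moreover have "ord ?A \<subseteq> carrier ?A \<times> carrier ?A" by auto
  ultimately have "natural_ordering J ?A (ord ?A)"
    unfolding natural_ordering_def strict_linear_order_on_def using proper ord by blast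
  then show ?thesis unfolding NA_def using alg by blast
qed

section \<open>Embeddings as typed rigid words\<close>

definition word_hom :: "nat list \<Rightarrow> nat \<Rightarrow> nat" where
  "word_hom w x = set_encode {b. b < length w \<and> w ! b \<in> set_decode x}"

lemma set_decode_word_hom [simp]:
  "set_decode (word_hom w x) = {b. b < length w \<and> w ! b \<in> set_decode x}"
  unfolding word_hom_def by (rule set_encode_inverse) simp

lemma word_hom_comp:
  assumes "set g \<subseteq> {..<length f}"
  shows "word_hom g (word_hom f x) = word_hom (map ((!) f) g) x"
  using assms nth_mem by (auto simp: eq_iff_set_decode_eq)

text \<open>
  The order is preserved because the least position at which two elements differ is mapped to its
  first occurrence, before which only smaller letters stand. The ideals are preserved because the
  position of first occurrence has the smallest type among all positions with the same letter.
\<close>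

lemma embedding_word_hom:
  assumes w: "typed_rigid U T w" and U: "sorted_wrt (\<le>) U"
  shows "embedding J (type_alg T) (type_alg U) (word_hom w)"
proof -
  have len: "length w = length U" and lt: "\<And>b. b < length U \<Longrightarrow> w ! b < length T"
    using w nth_mem unfolding typed_rigid_def by (auto simp: subset_iff)
  have first: "\<exists>b<length U. w ! b = i \<and> U ! b = T ! i \<and> (\<forall>c<b. w ! c < i)" if "i < length T" for i
    using w that unfolding typed_rigid_def by blast
  have onto: "\<exists>b<length U. w ! b = i" if "i < length T" for i using first[OF that] by blast
  have mono: "U ! b \<subseteq> U ! c" if "b \<le> c" "c < length U" for b c
    using U that sorted_wrt_nth_less[of "(\<le>)" U b c] by (cases "b = c") auto
  have fwd: "first_diff (set_decode (word_hom w x)) (set_decode (word_hom w y))"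
    if "set_decode y \<subseteq> {..<length T}" and fd: "first_diff (set_decode x) (set_decode y)" for x y
  proof -
    obtain i where i: "i \<in> set_decode y - set_decode x" "\<forall>k<i. k \<in> set_decode x \<longleftrightarrow> k \<in> set_decode y"
      using fd unfolding first_diff_def by blast
    then have "i < length T" using that(1) by auto
    then obtain b where b: "b < length U" "w ! b = i" "\<forall>c<b. w ! c < i" using first by blast
    have "c \<in> set_decode (word_hom w x) \<longleftrightarrow> c \<in> set_decode (word_hom w y)" if "c < b" for c
      using i(2) b(3) that by simp
    then show ?thesis unfolding first_diff_def using i(1) b len by (intro bexI[of _ b]) auto
  qed
  have eq: "set_decode x = set_decode y"
    if "set_decode x \<subseteq> {..<length T}" "set_decode y \<subseteq> {..<length T}" "word_hom w x = word_hom w y" for x y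
  proof -
    have same: "w ! b \<in> set_decode x \<longleftrightarrow> w ! b \<in> set_decode y" if "b < length w" for b
    proof -
      have "b \<in> set_decode (word_hom w x) \<longleftrightarrow> b \<in> set_decode (word_hom w y)"
        using \<open>word_hom w x = word_hom w y\<close> by simp
      then show ?thesis using that by simp
    qed
    show ?thesis
    proof (rule set_eqI)
      fix i
      show "i \<in> set_decode x \<longleftrightarrow> i \<in> set_decode y"
      proof (cases "i < length T")
        case True
        then obtain b where "b < length w" "w ! b = i" using onto len by metis
        then show ?thesis using same[of b] by simp
      next
        case False
        then show ?thesis using that(1,2) by auto
      qed
    qed
  qed
  have pred: "(x \<in> pred (type_alg T) j) = (word_hom w x \<in> pred (type_alg U) j)"
    if x: "set_decode x \<subseteq> {..<length T}" for x j
  proof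
    assume l: "x \<in> pred (type_alg T) j"
    have "j \<in> U ! c" if c: "c < length w" "w ! c \<in> set_decode x" for c
    proof -
      have "w ! c < length T" using c lt len by simp
      then obtain b where b: "b < length U" "w ! b = w ! c" "U ! b = T ! (w ! c)" "\<forall>c'<b. w ! c' < w ! c"
        using first by blast
      have "b \<le> c" using b(4) by (metis less_irrefl not_le_imp_less)
      then have "T ! (w ! c) \<subseteq> U ! c" using mono[of b c] b(3) c(1) len by simp
      then show ?thesis using l c(2) by auto
    qed
    then show "word_hom w x \<in> pred (type_alg U) j" using len by auto
  next
    assume r: "word_hom w x \<in> pred (type_alg U) j"
    have "j \<in> T ! i" if "i \<in> set_decode x" for i
    proof -
      obtain b where "b < length U" "w ! b = i" "U ! b = T ! i" using first x \<open>i \<in> _\<close> by blast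
      then show ?thesis using r that len by auto
    qed
    then show "x \<in> pred (type_alg T) j" using x by auto
  qed
  have ord: "((x, y) \<in> ord (type_alg T)) = ((word_hom w x, word_hom w y) \<in> ord (type_alg U))"
    if x: "set_decode x \<subseteq> {..<length T}" and y: "set_decode y \<subseteq> {..<length T}" for x y
  proof -
    have "first_diff (set_decode (word_hom w x)) (set_decode (word_hom w y)) \<Longrightarrow>
        first_diff (set_decode x) (set_decode y)"
      using fwd[OF x, of y] first_diff_total[of "set_decode x" "set_decode y"] first_diff_trans first_diff_irrefl
        eq_iff_set_decode_eq by metis
    then show ?thesis using fwd[OF y, of x] x y len by auto
  qed
  show ?thesis
    unfolding embedding_def
  proof (intro conjI ballI)
    show "inj_on (word_hom w) (carrier (type_alg T))"
      by (rule inj_onI) (use eq in \<open>auto simp: eq_iff_set_decode_eq[of _ "_ :: nat"]\<close>)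
  next
    fix j x assume "x \<in> carrier (type_alg T)"
    then show "(x \<in> pred (type_alg T) j) = (word_hom w x \<in> pred (type_alg U) j)" using pred by simp
  next
    fix x y assume "x \<in> carrier (type_alg T)" "y \<in> carrier (type_alg T)"
    then show "((x, y) \<in> ord (type_alg T)) = ((word_hom w x, word_hom w y) \<in> ord (type_alg U))"
      using ord by simp
  qed (use len lt in \<open>auto simp: eq_iff_set_decode_eq[of "word_hom w _"]\<close>)
qed

text \<open>
  The letter of \<open>w\<close> at \<open>b\<close> is the unique atom whose image contains \<open>b\<close>. If a letter \<open>k > i\<close> occurred
  before the first \<open>i\<close>, then the embedding would reverse the order of the atoms \<open>i\<close> and \<open>k\<close>; and the type
  of the image of \<open>i\<close>, the intersection of the types of its positions, is the type of the first one.
\<close>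

lemma embedding_imp_word:
  assumes h: "embedding J (type_alg S) (type_alg T) h" and T: "sorted_wrt (\<le>) T"
    and sub: "\<And>t. t \<in> set S \<union> set T \<Longrightarrow> t \<subseteq> J"
  obtains w where "typed_rigid T S w" "\<And>x. x \<in> carrier (type_alg S) \<Longrightarrow> h x = word_hom w x"
proof -
  let ?A = "type_alg S" and ?B = "type_alg T"
  have hB: "set_decode (h x) \<subseteq> {..<length T}" if "set_decode x \<subseteq> {..<length S}" for x
    using h that unfolding embedding_def by (auto simp: image_subset_iff)
  have h_join: "set_decode (h (x \<squnion>\<^bsub>?A\<^esub> y)) = set_decode (h x) \<union> set_decode (h y)"
    and h_meet: "set_decode (h (x \<sqinter>\<^bsub>?A\<^esub> y)) = set_decode (h x) \<inter> set_decode (h y)"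
    if "set_decode x \<subseteq> {..<length S}" "set_decode y \<subseteq> {..<length S}" for x y
    using h that unfolding embedding_def by auto
  have h_zero: "set_decode (h \<zero>\<^bsub>?A\<^esub>) = {}" and h_one: "set_decode (h \<one>\<^bsub>?A\<^esub>) = {..<length T}"
    using h unfolding embedding_def by auto
  have h_inj: "x = y" if "set_decode x \<subseteq> {..<length S}" "set_decode y \<subseteq> {..<length S}" "h x = h y" for x y
    using h that unfolding embedding_def by (auto dest: inj_onD)
  have h_ord: "(x, y) \<in> ord ?A \<longleftrightarrow> (h x, h y) \<in> ord ?B"
    if "x \<in> carrier ?A" "y \<in> carrier ?A" for x y
    using h that unfolding embedding_def by blast
  have h_pred: "x \<in> pred ?A j \<longleftrightarrow> h x \<in> pred ?B j" if "x \<in> carrier ?A" "j \<in> J" for x j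
    using h that unfolding embedding_def by blast
  define F where "F i = set_decode (h (set_encode {i}))" for i
  have cover: "set_decode (h (set_encode X)) \<subseteq> (\<Union>i\<in>X. F i)" if "finite X" "X \<subseteq> {..<length S}" for X
    using that
  proof (induction X rule: finite_induct)
    case empty
    then show ?case using h_zero by (simp add: type_alg_def)
  next
    case (insert i X)
    have "set_encode (insert i X) = set_encode {i} \<squnion>\<^bsub>?A\<^esub> set_encode X"
      unfolding eq_iff_set_decode_eq using insert.hyps by simp
    then show ?case using insert h_join[of "set_encode {i}" "set_encode X"] by (auto simp: F_def)
  qed
  have one: "\<one>\<^bsub>?A\<^esub> = set_encode {..<length S}" by (simp add: type_alg_def)
  have ex: "\<exists>i<length S. b \<in> F i" if "b < length T" for b
    using cover[of "{..<length S}"] h_one that unfolding one by auto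
  define w where "w = map (\<lambda>b. SOME i. i < length S \<and> b \<in> F i) [0..<length T]"
  have len: "length w = length T" by (simp add: w_def)
  have w: "w ! b < length S" "b \<in> F (w ! b)" if "b < length T" for b
    using someI_ex[OF ex[OF that]] that unfolding w_def by auto
  have hx: "b \<in> set_decode (h x) \<longleftrightarrow> w ! b \<in> set_decode x"
    if b: "b < length T" and x: "set_decode x \<subseteq> {..<length S}" for b x
  proof -
    let ?e = "set_encode {w ! b}"
    have e: "set_decode ?e \<subseteq> {..<length S}" using w[OF b] by simp
    have "b \<in> set_decode (h (?e \<sqinter>\<^bsub>?A\<^esub> x)) \<longleftrightarrow> b \<in> set_decode (h x)"
      using h_meet[OF e x] w(2)[OF b] unfolding F_def by simp
    moreover have "?e \<sqinter>\<^bsub>?A\<^esub> x = (if w ! b \<in> set_decode x then ?e else \<zero>\<^bsub>?A\<^esub>)"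
      by (auto simp: eq_iff_set_decode_eq)
    ultimately show ?thesis using h_zero w(2)[OF b] by (auto simp: F_def split: if_splits)
  qed
  have mem_F: "b \<in> F i \<longleftrightarrow> b < length T \<and> w ! b = i" if "i < length S" for i b
    using hx[of b "set_encode {i}"] hB[of "set_encode {i}"] that by (auto simp: F_def)
  have hw: "h x = word_hom w x" if "x \<in> carrier ?A" for x
    unfolding eq_iff_set_decode_eq using hx[of _ x] hB[of x] that len by auto
  have "typed_rigid T S w"
    unfolding typed_rigid_def
  proof (intro conjI allI impI)
    show "set w \<subseteq> {..<length S}" using w len by (auto simp: in_set_conv_nth)
    fix i assume i: "i < length S"
    have "F i \<noteq> {}"
    proof
      assume "F i = {}"
      then have "h (set_encode {i}) = h \<zero>\<^bsub>?A\<^esub>" using h_zero unfolding F_def eq_iff_set_decode_eq[of "h _"] by simp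
      then have "set_encode {i} = \<zero>\<^bsub>?A\<^esub>"
        using h_inj[of "set_encode {i}" "\<zero>\<^bsub>?A\<^esub>"] i by simp
      then show False by (simp add: eq_iff_set_decode_eq[of "set_encode {i}"])
    qed
    define b where "b = (LEAST b. b \<in> F i)"
    have b: "b \<in> F i" unfolding b_def using \<open>F i \<noteq> {}\<close> by (metis LeastI ex_in_conv)
    have least: "c \<notin> F i" if "c < b" for c using that not_less_Least unfolding b_def by blast
    have b': "b < length T" "w ! b = i" using b mem_F[OF i] by auto
    have small: "w ! c < i" if c: "c < b" for c
    proof (rule ccontr)
      assume "\<not> w ! c < i"
      moreover have ck: "c < length T" "w ! c < length S" using c b'(1) w(1)[of c] by auto
      moreover have "w ! c \<noteq> i" using least[OF c] mem_F[OF i] ck by blast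
      ultimately have ki: "i < w ! c" by simp
      let ?k = "w ! c"
      have "first_diff {?k} {i}" unfolding first_diff_def using ki by auto
      then have "(set_encode {?k}, set_encode {i}) \<in> ord ?A" using i ck by simp
      then have "(h (set_encode {?k}), h (set_encode {i})) \<in> ord ?B"
        using h_ord[of "set_encode {?k}" "set_encode {i}"] i ck by simp
      then have "first_diff (F ?k) (F i)" unfolding F_def by simp
      then obtain p where p: "p \<in> F i" "\<forall>q<p. q \<in> F ?k \<longleftrightarrow> q \<in> F i" unfolding first_diff_def by blast
      have "b \<le> p" using p(1) least[of p] by (cases "p < b") simp_all
      then have "c \<in> F i" using p(2) c w(2)[OF ck(1)] by auto
      then show False using least[OF c] by blast
    qed
    have "j \<in> T ! b \<longleftrightarrow> j \<in> S ! i" if j: "j \<in> J" for j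
    proof -
      have "j \<in> S ! i \<longleftrightarrow> set_encode {i} \<in> pred ?A j" using i by simp
      also have "\<dots> \<longleftrightarrow> h (set_encode {i}) \<in> pred ?B j" using h_pred[of "set_encode {i}" j] i j by simp
      also have "\<dots> \<longleftrightarrow> (\<forall>c\<in>F i. j \<in> T ! c)" unfolding F_def using hB[of "set_encode {i}"] i by simp
      also have "\<dots> \<longleftrightarrow> j \<in> T ! b"
      proof
        assume jb: "j \<in> T ! b"
        show "\<forall>c\<in>F i. j \<in> T ! c"
        proof
          fix c assume c: "c \<in> F i"
          have "b \<le> c" using least[of c] c by (cases "c < b") simp_all
          moreover have "c < length T" using c mem_F[OF i] by simp
          ultimately have "T ! b \<subseteq> T ! c" using T sorted_wrt_nth_less[of "(\<le>)" T b c] by (cases "b = c") auto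
          then show "j \<in> T ! c" using jb by blast
        qed
      qed (use b in blast)
      finally show ?thesis by simp
    qed
    moreover have "T ! b \<subseteq> J" "S ! i \<subseteq> J" using sub b'(1) i by auto
    ultimately have "T ! b = S ! i" by blast
    then show "\<exists>b<length T. w ! b = i \<and> T ! b = S ! i \<and> (\<forall>c<b. w ! c < i)"
      using b' small by blast
  qed (use len in simp)
  then show thesis using hw that by blast
qed

section \<open>Finite Boolean algebras are atomic\<close>

context bool_alg
begin

lemma meet_idem: "x \<in> carrier A \<Longrightarrow> x \<sqinter> x = x"
  using meet_absorb[of x "x \<sqinter> x"] join_absorb[of x x] meet_closed by simp

lemma meet_one: "x \<in> carrier A \<Longrightarrow> x \<sqinter> \<one> = x"
  using meet_absorb[of x "\<sim> x"] join_neg[of x] neg_closed by simp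

lemma join_zero: "x \<in> carrier A \<Longrightarrow> x \<squnion> \<zero> = x"
  using join_absorb[of x "\<sim> x"] meet_neg[of x] neg_closed by simp

lemma meet_zero: "x \<in> carrier A \<Longrightarrow> x \<sqinter> \<zero> = \<zero>"
  by (metis meet_neg meet_assoc meet_idem neg_closed)

lemma below_refl: "x \<in> carrier A \<Longrightarrow> below A x x"
  by (simp add: below_def meet_idem)

lemma below_trans:
  "\<lbrakk>x \<in> carrier A; y \<in> carrier A; z \<in> carrier A; below A x y; below A y z\<rbrakk> \<Longrightarrow> below A x z"
  unfolding below_def by (metis meet_assoc)

lemma below_antisym:
  "\<lbrakk>x \<in> carrier A; y \<in> carrier A; below A x y; below A y x\<rbrakk> \<Longrightarrow> x = y"
  unfolding below_def by (metis meet_comm)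

lemma meet_below1: "\<lbrakk>x \<in> carrier A; y \<in> carrier A\<rbrakk> \<Longrightarrow> below A (x \<sqinter> y) x"
  unfolding below_def by (metis meet_assoc meet_comm meet_idem)

lemma meet_below2: "\<lbrakk>x \<in> carrier A; y \<in> carrier A\<rbrakk> \<Longrightarrow> below A (x \<sqinter> y) y"
  unfolding below_def by (metis meet_assoc meet_idem)

lemma below_meet_iff:
  assumes "x \<in> carrier A" "y \<in> carrier A" "z \<in> carrier A"
  shows "below A z (x \<sqinter> y) \<longleftrightarrow> below A z x \<and> below A z y"
proof
  assume "below A z (x \<sqinter> y)"
  then show "below A z x \<and> below A z y"
    using below_trans meet_below1 meet_below2 meet_closed assms by metis
next
  assume "below A z x \<and> below A z y"
  then show "below A z (x \<sqinter> y)"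
    unfolding below_def using meet_assoc assms by metis
qed

lemma atom_carrier: "a \<in> atoms A \<Longrightarrow> a \<in> carrier A"
  by (simp add: atoms_def)

lemma atom_meet:
  assumes "a \<in> atoms A" "x \<in> carrier A"
  shows "a \<sqinter> x = \<zero> \<or> below A a x"
proof -
  have "a \<sqinter> x = \<zero> \<or> a \<sqinter> x = a"
    using assms meet_below1[of a x] meet_closed unfolding atoms_def by blast
  then show ?thesis by (auto simp: below_def)
qed

lemma atom_below_zero: "a \<in> atoms A \<Longrightarrow> \<not> below A a \<zero>"
  using meet_zero unfolding atoms_def below_def by force

lemma atom_below_join:
  assumes a: "a \<in> atoms A" and x: "x \<in> carrier A" and y: "y \<in> carrier A"
  shows "below A a (x \<squnion> y) \<longleftrightarrow> below A a x \<or> below A a y"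
proof
  assume "below A a (x \<squnion> y)"
  then have "a = (a \<sqinter> x) \<squnion> (a \<sqinter> y)"
    using meet_distrib[OF atom_carrier[OF a] x y] by (simp add: below_def)
  then have "\<not> (a \<sqinter> x = \<zero> \<and> a \<sqinter> y = \<zero>)"
    using a join_zero[OF zero_closed] unfolding atoms_def by auto
  then show "below A a x \<or> below A a y" using atom_meet[OF a] x y by blast
next
  have "below A x (x \<squnion> y)" "below A y (x \<squnion> y)"
    unfolding below_def using meet_absorb join_comm x y by metis+
  then show "below A a x \<or> below A a y \<Longrightarrow> below A a (x \<squnion> y)"
    using below_trans atom_carrier[OF a] x y join_closed by metis
qed

lemma atom_below_neg:
  assumes a: "a \<in> atoms A" and x: "x \<in> carrier A"
  shows "below A a (\<sim> x) \<longleftrightarrow> \<not> below A a x"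
proof -
  have "below A a (x \<squnion> \<sim> x)"
    using meet_one atom_carrier[OF a] x by (simp add: join_neg below_def)
  moreover have "\<not> below A a (x \<sqinter> \<sim> x)"
    using atom_below_zero[OF a] x by (simp add: meet_neg)
  ultimately show ?thesis
    using atom_below_join below_meet_iff a x neg_closed atom_carrier by metis
qed

lemma atom_below_atom:
  assumes "a \<in> atoms A" "b \<in> atoms A" "below A a b"
  shows "a = b"
  using assms unfolding atoms_def by blast

text \<open>
  A nonzero element below \<open>x\<close> with the fewest elements below it is an atom.
\<close>

lemma atom_below:
  assumes fin: "finite (carrier A)" and x: "x \<in> carrier A" "x \<noteq> \<zero>"
  shows "\<exists>a\<in>atoms A. below A a x"
proof -
  define Z where "Z = {y \<in> carrier A. y \<noteq> \<zero> \<and> below A y x}"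
  define down where "down y = {z \<in> carrier A. below A z y}" for y
  have "x \<in> Z" using x below_refl unfolding Z_def by blast
  then obtain a where a: "a \<in> Z" "\<And>z. z \<in> Z \<Longrightarrow> card (down a) \<le> card (down z)"
    using ex_has_least_nat[of "\<lambda>y. y \<in> Z" x "\<lambda>y. card (down y)"] by blast
  have aC: "a \<in> carrier A" "a \<noteq> \<zero>" "below A a x" using a(1) unfolding Z_def by auto
  have "z = \<zero> \<or> z = a" if z: "z \<in> carrier A" "below A z a" for z
  proof (cases "z = \<zero>")
    case False
    then have "z \<in> Z" using z aC below_trans x(1) unfolding Z_def by blast
    moreover have "down z \<subseteq> down a" using z aC below_trans unfolding down_def by blast
    moreover have "finite (down a)" using fin unfolding down_def by simp
    ultimately have "down z = down a" using a(2) card_seteq by metis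
    then have "below A a z" using below_refl aC unfolding down_def by blast
    then show ?thesis using below_antisym z aC by blast
  qed simp
  then have "a \<in> atoms A" using aC unfolding atoms_def by blast
  then show ?thesis using aC by blast
qed

lemma below_if_atoms_below:
  assumes fin: "finite (carrier A)" and x: "x \<in> carrier A" and y: "y \<in> carrier A"
    and sub: "\<And>a. a \<in> atoms A \<Longrightarrow> below A a x \<Longrightarrow> below A a y"
  shows "below A x y"
proof -
  have "x \<sqinter> \<sim> y = \<zero>"
  proof (rule ccontr)
    assume "x \<sqinter> \<sim> y \<noteq> \<zero>"
    then obtain a where a: "a \<in> atoms A" "below A a (x \<sqinter> \<sim> y)"
      using atom_below[OF fin] meet_closed neg_closed x y by blast
    then show False
      using below_meet_iff[OF x neg_closed[OF y] atom_carrier] atom_below_neg[OF _ y] sub by blast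
  qed
  then have "x = (x \<sqinter> y) \<squnion> \<zero>"
    using meet_distrib[OF x y neg_closed[OF y]] join_neg[OF y] meet_one[OF x] by simp
  then show ?thesis using join_zero meet_closed x y by (simp add: below_def)
qed

lemma eq_if_same_atoms:
  assumes "finite (carrier A)" "x \<in> carrier A" "y \<in> carrier A"
    and "\<And>a. a \<in> atoms A \<Longrightarrow> below A a x \<longleftrightarrow> below A a y"
  shows "x = y"
  using assms below_if_atoms_below below_antisym by metis

text \<open>
  Every set of atoms is the set of atoms below some element. The join can be taken within any set
  \<open>I\<close> closed under joins, which for an ideal shows that membership depends only on the atoms below.
\<close>

lemma join_of_atoms:
  assumes "finite F" "F \<subseteq> atoms A" "\<zero> \<in> I" "F \<subseteq> I" "I \<subseteq> carrier A"
    and "\<And>x y. x \<in> I \<Longrightarrow> y \<in> I \<Longrightarrow> x \<squnion> y \<in> I"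
  shows "\<exists>x\<in>I. \<forall>a\<in>atoms A. below A a x \<longleftrightarrow> a \<in> F"
  using assms(1,2,4)
proof (induction F rule: finite_induct)
  case empty
  then show ?case using assms(3) atom_below_zero by blast
next
  case (insert b F)
  then obtain x where x: "x \<in> I" "\<forall>a\<in>atoms A. below A a x \<longleftrightarrow> a \<in> F" by auto
  have b: "b \<in> atoms A" "b \<in> I" using insert.prems by auto
  have "below A a (x \<squnion> b) \<longleftrightarrow> a \<in> insert b F" if "a \<in> atoms A" for a
  proof -
    have "below A a b \<longleftrightarrow> a = b"
      using atom_below_atom[OF that b(1)] below_refl[OF atom_carrier[OF that]] by auto
    moreover have "x \<in> carrier A" using x(1) assms(5) by blast
    ultimately show ?thesis
      using atom_below_join[OF that _ atom_carrier[OF b(1)], of x] x(2) that by auto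
  qed
  then show ?case using assms(6)[OF x(1) b(2)] by blast
qed

end

section \<open>Naturally ordered algebras as lists of types\<close>

text \<open>
  An atom \<open>a\<close> is given the number \<open>rk a\<close> of atoms above it. That the types increase along this
  numbering is exactly the condition that the ordering is proper.
\<close>

lemma NA_representation:
  fixes A :: "('a, 'j::linorder) ord_pred_alg"
  assumes "A \<in> NA J"
  obtains T \<iota> where "type_list J T" "embedding J A (type_alg T) \<iota>"
    "\<iota> ` carrier A = carrier (type_alg T)"
proof -
  have alg: "A \<in> ideal_chain_algs J" and nat: "natural_ordering J A (ord A)"
    using assms unfolding NA_def by auto
  interpret bool_alg A using alg unfolding ideal_chain_algs_def by blast
  have fin: "finite (carrier A)" and ideal: "\<And>j. j \<in> J \<Longrightarrow> is_ideal A (pred A j)"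
    and chain: "\<And>i j. i \<in> J \<Longrightarrow> j \<in> J \<Longrightarrow> i < j \<Longrightarrow> pred A i \<subseteq> pred A j"
    and "\<exists>a\<in>atoms A. \<forall>j\<in>J. a \<notin> pred A j"
    using alg unfolding ideal_chain_algs_def by auto
  then obtain a0 where a0: "a0 \<in> atoms A" "\<And>j. j \<in> J \<Longrightarrow> a0 \<notin> pred A j" by blast
  have fin_atoms: "finite (atoms A)" using fin finite_subset[of "atoms A" "carrier A"] atom_carrier by blast
  obtain r where r: "proper_ordering J A r" "ord A = antilex A r"
    using nat unfolding natural_ordering_def by blast
  have "trans r" "irrefl r" and total: "total_on (atoms A) r" and r_sub: "r \<subseteq> atoms A \<times> atoms A"
    and proper: "\<And>a b i. a \<in> atoms A \<Longrightarrow> b \<in> atoms A \<Longrightarrow> i \<in> J \<Longrightarrow> a \<in> pred A i \<Longrightarrow>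
      (\<exists>j\<in>J. i < j \<and> b \<in> pred A j - pred A i) \<or> (\<forall>k\<in>J. b \<notin> pred A k) \<Longrightarrow> (a, b) \<in> r"
    using r(1) unfolding proper_ordering_def strict_linear_order_on_def by blast+
  define rk where "rk a = card {b. (a, b) \<in> r}" for a
  let ?n = "card (atoms A)"
  have fin_up: "finite {b. (a, b) \<in> r}" for a
    using r_sub fin_atoms by (auto intro: finite_subset[of _ "atoms A"])
  have rk_less: "rk b < rk a" if "(a, b) \<in> r" for a b
  proof -
    have "{c. (b, c) \<in> r} \<subseteq> {c. (a, c) \<in> r}" using \<open>trans r\<close> that by (auto dest: transD)
    moreover have "b \<notin> {c. (b, c) \<in> r}" "b \<in> {c. (a, c) \<in> r}"
      using \<open>irrefl r\<close> that by (auto simp: irrefl_def)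
    ultimately have "{c. (b, c) \<in> r} \<subset> {c. (a, c) \<in> r}" by blast
    then show ?thesis unfolding rk_def using fin_up psubset_card_mono by blast
  qed
  have rk_iff: "(a, b) \<in> r \<longleftrightarrow> rk b < rk a" if "a \<in> atoms A" "b \<in> atoms A" for a b
    using rk_less[of a b] rk_less[of b a] total that unfolding total_on_def
    by (metis less_asym less_irrefl)
  have inj: "inj_on rk (atoms A)"
    using rk_iff total unfolding total_on_def inj_on_def by (metis less_irrefl)
  have rk_lt: "rk a < ?n" if "a \<in> atoms A" for a
  proof -
    have "{b. (a, b) \<in> r} \<subset> atoms A" using r_sub \<open>irrefl r\<close> that by (auto simp: irrefl_def)
    then show ?thesis unfolding rk_def using fin_atoms psubset_card_mono by blast
  qed
  have rk_image: "rk ` atoms A = {..<?n}"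
    using rk_lt inj by (intro card_subset_eq) (auto simp: card_image)
  define at where "at = the_inv_into (atoms A) rk"
  have at: "at i \<in> atoms A" "rk (at i) = i" if "i < ?n" for i
    unfolding at_def using that rk_image inj
    by (auto intro: the_inv_into_into f_the_inv_into_f)
  define ty where "ty a = {j \<in> J. a \<in> pred A j}" for a
  define T where "T = map (\<lambda>i. ty (at i)) [0..<?n]"
  have len: "length T = ?n" by (simp add: T_def)
  have T_rk: "T ! rk a = ty a" if "a \<in> atoms A" for a
    using rk_lt[OF that] that inj unfolding T_def at_def by (simp add: the_inv_into_f_f)
  have pos: "0 < ?n" using a0(1) fin_atoms card_gt_0_iff by blast
  have ty_mono: "ty a \<subseteq> ty b" if ab: "a \<in> atoms A" "b \<in> atoms A" "rk a < rk b" for a b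
  proof
    fix j assume j: "j \<in> ty a"
    then have jJ: "j \<in> J" "a \<in> pred A j" unfolding ty_def by auto
    show "j \<in> ty b"
    proof (rule ccontr)
      assume "j \<notin> ty b"
      then have nb: "b \<notin> pred A j" using jJ unfolding ty_def by blast
      have "j < k" if "k \<in> J" "b \<in> pred A k" for k
        using that nb chain[of k j] jJ(1) by (cases j k rule: linorder_cases) auto
      then have "(\<exists>k\<in>J. j < k \<and> b \<in> pred A k - pred A j) \<or> (\<forall>k\<in>J. b \<notin> pred A k)"
        using nb by blast
      then have "(a, b) \<in> r" using proper[OF ab(1,2) jJ] by blast
      then show False using rk_less[of a b] ab(3) by simp
    qed
  qed
  have T0: "T ! 0 = {}"
  proof -
    have z: "at 0 \<in> atoms A" "rk (at 0) = 0" using at[OF pos] by auto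
    have "at 0 \<notin> pred A i" if i: "i \<in> J" for i
    proof
      assume "at 0 \<in> pred A i"
      then have "(at 0, a0) \<in> r" using proper[OF z(1) a0(1) i] a0(2) by blast
      then show False using rk_less[of "at 0" a0] z(2) by simp
    qed
    then show ?thesis using T_rk[OF z(1)] z(2) unfolding ty_def by auto
  qed
  have T_sorted: "sorted_wrt (\<le>) T"
    unfolding sorted_wrt_iff_nth_less
  proof (intro allI impI)
    fix i k assume "i < k" "k < length T"
    then show "T ! i \<le> T ! k"
      using ty_mono[of "at i" "at k"] at[of i] at[of k] len by (simp add: T_def)
  qed
  have "t \<subseteq> J \<and> (\<forall>i\<in>t. \<forall>j\<in>J. i < j \<longrightarrow> j \<in> t)" if "t \<in> set T" for t
    using that chain unfolding T_def ty_def by auto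
  then have valid: "type_list J T"
    unfolding type_list_def using T0 T_sorted pos len by auto
  define at_below where "at_below x = {a \<in> atoms A. below A a x}" for x
  define \<iota> where "\<iota> x = set_encode (rk ` at_below x)" for x
  have fin_below: "finite (at_below x)" for x unfolding at_below_def using fin_atoms by simp
  have dec: "set_decode (\<iota> x) = rk ` at_below x" for x
    unfolding \<iota>_def using fin_below by (intro set_encode_inverse) simp
  have sub: "at_below x \<subseteq> atoms A" for x unfolding at_below_def by blast
  have dec_lt: "set_decode (\<iota> x) \<subseteq> {..<?n}" for x
    unfolding dec using sub rk_image by blast
  have mem: "rk a \<in> set_decode (\<iota> x) \<longleftrightarrow> below A a x" if "a \<in> atoms A" for a x
    unfolding dec using that inj_on_image_mem_iff[OF inj that sub] by (simp add: at_below_def)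
  have eqI: "u = v" if "set_decode u \<subseteq> {..<?n}" "set_decode v \<subseteq> {..<?n}"
    "\<And>a. a \<in> atoms A \<Longrightarrow> rk a \<in> set_decode u \<longleftrightarrow> rk a \<in> set_decode v" for u v
  proof -
    have "set_decode u = set_decode v" using that unfolding rk_image[symmetric] by blast
    then show ?thesis using eq_iff_set_decode_eq by blast
  qed
  have carrier_pred: "x \<in> pred A j \<longleftrightarrow> (\<forall>a\<in>atoms A. below A a x \<longrightarrow> a \<in> pred A j)"
    if x: "x \<in> carrier A" and j: "j \<in> J" for x j
  proof
    assume "x \<in> pred A j"
    then show "\<forall>a\<in>atoms A. below A a x \<longrightarrow> a \<in> pred A j"
      using ideal[OF j] atom_carrier unfolding is_ideal_def by blast
  next
    assume "\<forall>a\<in>atoms A. below A a x \<longrightarrow> a \<in> pred A j"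
    then obtain y where y: "y \<in> pred A j" "\<forall>a\<in>atoms A. below A a y \<longleftrightarrow> a \<in> at_below x"
      using join_of_atoms[OF fin_below sub, of "pred A j" x] ideal[OF j] unfolding is_ideal_def at_below_def by blast
    have "y \<in> carrier A" using y(1) ideal[OF j] unfolding is_ideal_def by blast
    then have "x = y" using eq_if_same_atoms[OF fin x] y(2) unfolding at_below_def by blast
    then show "x \<in> pred A j" using y(1) by simp
  qed
  have emb: "embedding J A (type_alg T) \<iota>"
    unfolding embedding_def
  proof (intro conjI ballI)
    show "\<iota> ` carrier A \<subseteq> carrier (type_alg T)" using dec_lt len by auto
    show "inj_on \<iota> (carrier A)"
    proof (rule inj_onI)
      fix x y assume "x \<in> carrier A" "y \<in> carrier A" "\<iota> x = \<iota> y"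
      then show "x = y" using eq_if_same_atoms[OF fin] mem by metis
    qed
    show "\<iota> \<zero>\<^bsub>A\<^esub> = \<zero>\<^bsub>type_alg T\<^esub>"
      using dec_lt mem atom_below_zero by (intro eqI) (auto simp: len)
    have "below A a \<one>\<^bsub>A\<^esub>" if "a \<in> atoms A" for a
      using meet_one atom_carrier[OF that] by (simp add: below_def)
    then show "\<iota> \<one>\<^bsub>A\<^esub> = \<one>\<^bsub>type_alg T\<^esub>"
      using dec_lt mem rk_lt by (intro eqI) (auto simp: len)
  next
    fix x y assume x: "x \<in> carrier A" and y: "y \<in> carrier A"
    show "\<iota> (x \<squnion>\<^bsub>A\<^esub> y) = \<iota> x \<squnion>\<^bsub>type_alg T\<^esub> \<iota> y"
      by (rule eqI) (use dec_lt mem atom_below_join x y in auto)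
    show "\<iota> (x \<sqinter>\<^bsub>A\<^esub> y) = \<iota> x \<sqinter>\<^bsub>type_alg T\<^esub> \<iota> y"
      by (rule eqI) (use dec_lt mem below_meet_iff[OF x y atom_carrier] in auto)
    have "(x, y) \<in> ord A \<longleftrightarrow> x \<noteq> y \<and> (\<exists>a\<in>atoms A. below A a y \<and> \<not> below A a x \<and>
        (\<forall>b\<in>atoms A. below A b x \<noteq> below A b y \<longrightarrow> b = a \<or> rk a < rk b))"
      unfolding r(2) antilex_def separates_def using x y rk_iff by auto
    also have "\<dots> \<longleftrightarrow> (\<exists>i<?n. i \<in> set_decode (\<iota> y) \<and> i \<notin> set_decode (\<iota> x) \<and>
        (\<forall>k<?n. (k \<in> set_decode (\<iota> x)) \<noteq> (k \<in> set_decode (\<iota> y)) \<longrightarrow> k = i \<or> i < k))"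
      (is "x \<noteq> y \<and> ?L \<longleftrightarrow> ?R")
    proof
      assume "x \<noteq> y \<and> ?L"
      then obtain a where a: "a \<in> atoms A" "below A a y" "\<not> below A a x"
        and later: "\<And>b. b \<in> atoms A \<Longrightarrow> below A b x \<noteq> below A b y \<Longrightarrow> b = a \<or> rk a < rk b"
        by (elim conjE bexE) (rule that, auto)
      have "k = rk a \<or> rk a < k" if "k < ?n" "(k \<in> set_decode (\<iota> x)) \<noteq> (k \<in> set_decode (\<iota> y))" for k
        using later[of "at k"] mem[of "at k"] at[OF that(1)] that(2) by auto
      then show ?R using mem[OF a(1)] a rk_lt by (intro exI[of _ "rk a"]) simp
    next
      assume ?R
      then obtain i where i: "i < ?n" "i \<in> set_decode (\<iota> y)" "i \<notin> set_decode (\<iota> x)"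
        and later: "\<And>k. k < ?n \<Longrightarrow> (k \<in> set_decode (\<iota> x)) \<noteq> (k \<in> set_decode (\<iota> y)) \<Longrightarrow> k = i \<or> i < k"
        by (elim conjE exE) (rule that, auto)
      have a: "at i \<in> atoms A" "rk (at i) = i" using at[OF i(1)] .
      have "b = at i \<or> rk (at i) < rk b" if b: "b \<in> atoms A" "below A b x \<noteq> below A b y" for b
      proof -
        have "rk b = i \<or> i < rk b" using later[OF rk_lt[OF b(1)]] mem[OF b(1)] b(2) by simp
        then show ?thesis using a inj_onD[OF inj, of b "at i"] b(1) by auto
      qed
      moreover have "below A (at i) y" "\<not> below A (at i) x" using mem[OF a(1)] a(2) i by simp_all
      moreover from this have "x \<noteq> y" by blast
      ultimately show "x \<noteq> y \<and> ?L" using a(1) by blast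
    qed
    also have "\<dots> \<longleftrightarrow> (\<iota> x, \<iota> y) \<in> ord (type_alg T)"
      unfolding first_diff_iff_greatest[OF dec_lt dec_lt, symmetric] using dec_lt len by simp
    finally show "((x, y) \<in> ord A) = ((\<iota> x, \<iota> y) \<in> ord (type_alg T))" .
  next
    fix x assume x: "x \<in> carrier A"
    show "\<iota> (\<sim>\<^bsub>A\<^esub> x) = \<sim>\<^bsub>type_alg T\<^esub> \<iota> x"
      by (rule eqI) (use dec_lt mem atom_below_neg x rk_lt in \<open>auto simp: len\<close>)
  next
    fix j x assume j: "j \<in> J" and x: "x \<in> carrier A"
    have "(\<forall>i\<in>set_decode (\<iota> x). j \<in> T ! i) \<longleftrightarrow> (\<forall>a\<in>at_below x. a \<in> pred A j)"
      unfolding dec using T_rk sub j by (auto simp: ty_def subset_iff)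
    then show "(x \<in> pred A j) = (\<iota> x \<in> pred (type_alg T) j)"
      using carrier_pred[OF x j] dec_lt len by (auto simp: at_below_def)
  qed
  have "u \<in> \<iota> ` carrier A" if u: "u \<in> carrier (type_alg T)" for u
  proof -
    let ?F = "{a \<in> atoms A. rk a \<in> set_decode u}"
    have "\<exists>x\<in>carrier A. \<forall>a\<in>atoms A. below A a x \<longleftrightarrow> a \<in> ?F"
      by (rule join_of_atoms) (use fin_atoms zero_closed atom_carrier join_closed in auto)
    then obtain x where x: "x \<in> carrier A" "\<forall>a\<in>atoms A. below A a x \<longleftrightarrow> a \<in> ?F" by blast
    have "u = \<iota> x" by (rule eqI) (use u dec_lt mem x len in auto)
    then show ?thesis using x(1) by blast
  qed
  then have "\<iota> ` carrier A = carrier (type_alg T)" using emb unfolding embedding_def by blast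
  then show thesis using that valid emb by blast
qed

section \<open>The Ramsey property\<close>

lemma NA_bool_alg: "A \<in> NA J \<Longrightarrow> bool_alg A"
  by (simp add: NA_def ideal_chain_algs_def)

theorem theorem4:
  fixes J :: "'j::linorder set"
  shows "ramsey_property J (NA J :: (nat, 'j) ord_pred_alg set)"
  unfolding ramsey_property_def
proof (intro ballI allI impI)
  fix A B :: "(nat, 'j) ord_pred_alg" and k :: nat
  assume A: "A \<in> NA J" and B: "B \<in> NA J" and k: "k \<ge> 2"
  obtain S \<alpha> where S: "type_list J S" and \<alpha>: "embedding J A (type_alg S) \<alpha>"
    "\<alpha> ` carrier A = carrier (type_alg S)"
    using NA_representation[OF A] .
  obtain T \<beta> where T: "type_list J T" and \<beta>: "embedding J B (type_alg T) \<beta>"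
    "\<beta> ` carrier B = carrier (type_alg T)"
    using NA_representation[OF B] .
  note bool = NA_bool_alg[OF A] NA_bool_alg[OF B] bool_alg_type_alg
  have id_emb: "embedding J X X id" for X :: "(nat, 'j) ord_pred_alg"
    by (simp add: embedding_def)
  obtain \<alpha>' where \<alpha>': "embedding J (type_alg S) A \<alpha>'"
    and inv: "\<And>x. x \<in> carrier (type_alg S) \<Longrightarrow> \<alpha> (\<alpha>' x) = x"
    using embedding_lift[OF bool(3,1) id_emb \<alpha>(1)] \<alpha>(2) by auto
  have \<alpha>'_onto: "\<alpha>' ` carrier (type_alg S) = carrier A"
  proof
    show "\<alpha>' ` carrier (type_alg S) \<subseteq> carrier A" using \<alpha>' by (simp add: embedding_def)
    show "carrier A \<subseteq> \<alpha>' ` carrier (type_alg S)"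
    proof
      fix y assume y: "y \<in> carrier A"
      then have "\<alpha> y \<in> carrier (type_alg S)" using \<alpha>(2) by blast
      moreover from this have "\<alpha>' (\<alpha> y) \<in> carrier A" using \<alpha>' unfolding embedding_def by blast
      ultimately have "\<alpha>' (\<alpha> y) = y"
        using inv y \<alpha>(1) unfolding embedding_def by (meson inj_onD)
      then show "y \<in> \<alpha>' ` carrier (type_alg S)" using \<open>\<alpha> y \<in> _\<close> by force
    qed
  qed
  have upset: "t \<subseteq> J \<and> (\<forall>i\<in>t. \<forall>j\<in>J. i < j \<longrightarrow> j \<in> t)" if "t \<in> set S \<union> set T" for t
    using that S T unfolding type_list_def by blast
  have comparable: "x \<le> y \<or> y \<le> x" if "x \<in> set S \<union> set T" "y \<in> set S \<union> set T" for x y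
    using upset[OF that(1)] upset[OF that(2)] by (metis linorder_neqE subset_iff)
  have sorted: "sorted_wrt (\<le>) S" "sorted_wrt (\<le>) T" using S T by (simp_all add: type_list_def)
  obtain U where U: "sorted_wrt (\<le>) U" "set U \<subseteq> set S \<union> set T"
    and ramsey: "\<And>\<chi> :: nat list \<Rightarrow> nat. (\<And>w. \<chi> w < k) \<Longrightarrow>
      \<exists>g. typed_rigid U T g \<and>
        (\<forall>f f'. typed_rigid T S f \<longrightarrow> typed_rigid T S f' \<longrightarrow> \<chi> (map ((!) f) g) = \<chi> (map ((!) f') g))"
    using typed_dual_ramsey[OF sorted comparable, of k thesis] that by simp
  have "type_list J U"
  proof -
    \<comment> \<open>The letter \<open>0\<close> of a rigid word occurs first at position \<open>0\<close>, so the lists \<open>U\<close> and \<open>T\<close> start with the same type.\<close>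
    obtain g where g: "typed_rigid U T g" using ramsey[of "\<lambda>_. 0"] k by auto
    have "0 < length T" using T by (simp add: type_list_def)
    then obtain b where b: "b < length U" "U ! b = T ! 0" "\<forall>c<b. g ! c < 0"
      using g unfolding typed_rigid_def by blast
    then have "U \<noteq> []" "U ! 0 = {}" using T by (auto simp: type_list_def)
    then show ?thesis unfolding type_list_def using U upset by blast
  qed
  let ?C = "type_alg U"
  show "\<exists>C\<in>NA J :: (nat, 'j) ord_pred_alg set. \<forall>\<chi>\<in>copies J A C \<rightarrow> {..<k}. \<exists>B'\<in>copies J B C.
      \<forall>A1\<in>copies J A B'. \<forall>A2\<in>copies J A B'. \<chi> A1 = \<chi> A2"
  proof (rule bexI[of _ ?C], rule ballI)
    show "?C \<in> NA J" using \<open>type_list J U\<close> by (rule type_alg_NA)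
  next
    fix \<chi> assume chi: "\<chi> \<in> copies J A ?C \<rightarrow> {..<k}"
    \<comment> \<open>A typed word is coloured by the colour of the copy of \<open>A\<close> that it describes.\<close>
    define copy where "copy w = substructure ?C (word_hom w ` carrier (type_alg S))" for w
    define col where "col w = (if copy w \<in> copies J A ?C then \<chi> (copy w) else 0)" for w
    have col_less: "col w < k" for w unfolding col_def using chi k by auto
    obtain g where g: "typed_rigid U T g"
      "\<And>f f'. typed_rigid T S f \<Longrightarrow> typed_rigid T S f' \<Longrightarrow> col (map ((!) f) g) = col (map ((!) f') g)"
      using ramsey[of col, OF col_less] by blast
    let ?Bg = "word_hom g ` carrier (type_alg T)"
    define B' where "B' = substructure ?C ?Bg"
    have g_emb: "embedding J (type_alg T) ?C (word_hom g)"
      using embedding_word_hom[OF g(1) U(1)] .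
    have "B' = substructure ?C ((word_hom g \<circ> \<beta>) ` carrier B)"
      unfolding B'_def image_comp[symmetric] \<beta>(2) ..
    moreover have "embedding J B ?C (word_hom g \<circ> \<beta>)" using embedding_comp[OF \<beta>(1) g_emb] .
    ultimately have B': "B' \<in> copies J B ?C" unfolding copies_eq_images[OF bool(2)] by blast
    have Bg_sub: "?Bg \<subseteq> carrier ?C" using g_emb by (simp add: embedding_def)
    have as_word: "\<exists>f. typed_rigid T S f \<and> X = copy (map ((!) f) g) \<and> X \<in> copies J A ?C"
      if X: "X \<in> copies J A B'" for X
    proof -
      obtain e where e: "X = substructure B' (e ` carrier A)" "embedding J A B' e"
        using X unfolding copies_eq_images[OF bool(1)] by blast
      have eC: "embedding J A ?C e" "e ` carrier A \<subseteq> ?Bg"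
        using iffD1[OF embedding_substructure_iff[OF Bg_sub] e(2)[unfolded B'_def]] by blast+
      have XC: "X = substructure ?C (e ` carrier A)"
        using e(1) substructure_substructure[OF eC(2)] unfolding B'_def by simp
      then have mem: "X \<in> copies J A ?C" unfolding copies_eq_images[OF bool(1)] using eC(1) by blast
      have im: "(e \<circ> \<alpha>') ` carrier (type_alg S) \<subseteq> ?Bg"
        unfolding image_comp[symmetric] \<alpha>'_onto by (rule eC(2))
      obtain h where h: "embedding J (type_alg S) (type_alg T) h"
        "\<forall>x\<in>carrier (type_alg S). word_hom g (h x) = (e \<circ> \<alpha>') x"
        using embedding_lift[OF bool(3) bool(3) embedding_comp[OF \<alpha>' eC(1)] g_emb im] by blast
      have "t \<subseteq> J" if "t \<in> set S \<union> set T" for t using upset[OF that] by blast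
      then obtain f where f: "typed_rigid T S f" "\<And>x. x \<in> carrier (type_alg S) \<Longrightarrow> h x = word_hom f x"
        using embedding_imp_word[OF h(1) sorted(2), of thesis] that by simp
      have "e ` carrier A = (e \<circ> \<alpha>') ` carrier (type_alg S)"
        unfolding image_comp[symmetric] \<alpha>'_onto ..
      also have "\<dots> = word_hom (map ((!) f) g) ` carrier (type_alg S)"
      proof (rule image_cong[OF refl])
        fix x assume x: "x \<in> carrier (type_alg S)"
        have "set g \<subseteq> {..<length f}" using g(1) f(1) unfolding typed_rigid_def by simp
        then show "(e \<circ> \<alpha>') x = word_hom (map ((!) f) g) x"
          using h(2) f(2)[OF x] x word_hom_comp by metis
      qed
      finally show ?thesis using f(1) XC mem unfolding copy_def by auto
    qed
    have "\<chi> A1 = \<chi> A2" if A1: "A1 \<in> copies J A B'" and A2: "A2 \<in> copies J A B'" for A1 A2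
    proof -
      obtain f1 where f1: "typed_rigid T S f1" "A1 = copy (map ((!) f1) g)" "A1 \<in> copies J A ?C"
        using as_word[OF A1] by blast
      obtain f2 where f2: "typed_rigid T S f2" "A2 = copy (map ((!) f2) g)" "A2 \<in> copies J A ?C"
        using as_word[OF A2] by blast
      show ?thesis using g(2)[OF f1(1) f2(1)] f1(2,3) f2(2,3) unfolding col_def by simp
    qed
    then show "\<exists>B'\<in>copies J B ?C. \<forall>A1\<in>copies J A B'. \<forall>A2\<in>copies J A B'. \<chi> A1 = \<chi> A2"
      using B' by blast
  qed
qed

end
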